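(* For every nonnegative integer $n$, $$a_{3,10}(10n+5)\equiv 0 \pmod 5.$$
   Context: Notation, for $|q|<1$: $(a;q)_\infty:=\prod_{k=0}^{\infty}(1-aq^k)$ and $(a_1,\ldots,a_k;q)_\infty:=(a_1;q)_\infty\cdots(a_k;q)_\infty$. For an integer $p\ge 2$ and an integer $1\le j\le p-1$ coprime to $p$, the numbers $a_{j,p}(n)$, $n\ge 0$, are the power series coefficients defined by $$\sum_{n=0}^\infty a_{j,p}(n)q^n=\frac{1}{(q^j,q^{p-j},q^p;q^p)_\infty}\sum_{n=-\infty}^\infty \frac{(-1)^nq^{pn(n+1)/2+jn+j}}{1-q^{pn+j}}.$$ Here the case $p=10$, $j=3$ is used. *)

theory Defs
  imports "HOL-Analysis.Analysis" "HOL-Number_Theory.Cong"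
begin

definition qpoch_inf :: "complex \<Rightarrow> complex \<Rightarrow> complex" where
  "qpoch_inf a q = (\<Prod>k. 1 - a * q ^ k)"

definition appell_gf :: "nat \<Rightarrow> nat \<Rightarrow> complex \<Rightarrow> complex" where
  "appell_gf j p q =
     1 / (qpoch_inf (q ^ j) (q ^ p) * qpoch_inf (q ^ (p - j)) (q ^ p) * qpoch_inf (q ^ p) (q ^ p)) *
     (\<Sum>\<^sub>\<infinity>n::int. (-1) powi n * q powi (int p * n * (n + 1) div 2 + int j * n + int j) /
                    (1 - q powi (int p * n + int j)))"

text \<open>
  The coefficients for \<open>p \<ge> 2\<close>, \<open>1 \<le> j \<le> p - 1\<close> and \<open>j\<close> coprime to \<open>p\<close>.
  They are integers: every summand with \<open>n < 0\<close> equals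
  \<open>- (-1) powi n * q powi (p * n * (n - 1) div 2 + j * n) / (1 - q powi (- p * n - j))\<close>,
  whose exponents are positive.  The point \<open>q = 0\<close> is left out because these summands contain
  negative powers of \<open>q\<close> as written, and \<open>0 powi m = 0\<close> for \<open>m < 0\<close> makes the summand for
  \<open>n = -1\<close> equal to \<open>-1\<close> at \<open>q = 0\<close> instead of its limit \<open>0\<close>.  The punctured disc
  determines the coefficients.
\<close>

definition appell_coeff :: "nat \<Rightarrow> nat \<Rightarrow> nat \<Rightarrow> int" where
  "appell_coeff j p = (THE a. \<forall>q::complex. 0 < norm q \<and> norm q < 1 \<longrightarrow>
     (\<lambda>n. of_int (a n) * q ^ n) sums appell_gf j p q)"

end

theory Submission
  imports Defs "HOL-Complex_Analysis.Complex_Analysis" "HOL-Real_Asymp.Real_Asymp"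
begin

text \<open>
  Put \<open>x = q^3\<close> and \<open>Q = q^10\<close>.  As a function of \<open>x\<close>, the generating function \<open>f\<close> is elliptic
  with period \<open>Q\<close> and a double pole at \<open>x = 1\<close>, so it has the form \<open>D f = C + P\<close> with
  \<open>P = (\<Sum>m\<noteq>0. m x^m / (1 - Q^m))\<close> and \<open>C\<close>, \<open>D\<close> independent of \<open>x\<close>.  This is proved by comparing
  Laurent coefficients in \<open>x\<close> after multiplication by the theta series: both sides satisfy the same
  first order recurrence.  Hence \<open>C\<close> and \<open>D\<close> are power series in \<open>q^10\<close>, and \<open>D\<close> has constant term
  1.  The coefficient of \<open>q^N\<close> in \<open>P\<close> is a sum of terms \<open>\<bar>m\<bar>\<close> over \<open>m (10 k + 3) = N\<close>; if
  \<open>N = 10 n + 5\<close>, then \<open>5\<close> divides each such \<open>m\<close>, because \<open>5\<close> does not divide \<open>10 k + 3\<close>.  The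
  divisibility of the coefficients of \<open>f\<close> follows by recursion.
\<close>

section \<open>Power series with integer coefficients on the unit disc\<close>

text \<open>Agreement with \<open>G\<close> is asked only away from 0, because the summands of
  \<open>appell_gf\<close> contain negative powers of q and need not take their limit value
  there.\<close>

definition int_series :: "complex fps \<Rightarrow> (complex \<Rightarrow> complex) \<Rightarrow> bool" where
  "int_series F G \<longleftrightarrow> 1 \<le> fps_conv_radius F \<and> (\<forall>n. fps_nth F n \<in> \<int>) \<and>
     (\<forall>q. 0 < norm q \<and> norm q < 1 \<longrightarrow> eval_fps F q = G q)"

lemma int_series_sums:
  assumes "int_series F G" "0 < norm q" "norm q < 1"
  shows "(\<lambda>n. fps_nth F n * q ^ n) sums G q"
proof -
  have "ereal (norm q) < fps_conv_radius F"
    using assms by (auto simp: int_series_def intro: less_le_trans[of _ 1])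
  from sums_eval_fps[OF this] show ?thesis
    using assms by (simp add: int_series_def)
qed

lemma int_seriesI:
  assumes "\<And>n. fps_nth F n \<in> \<int>"
    and s: "\<And>q. 0 < norm q \<Longrightarrow> norm q < 1 \<Longrightarrow> (\<lambda>n. fps_nth F n * q ^ n) sums G q"
  shows "int_series F G"
proof -
  have "1 \<le> fps_conv_radius F" unfolding fps_conv_radius_def
  proof (rule conv_radius_geI_ex)
    fix r :: real assume "0 < r" "ereal r < 1"
    thus "\<exists>z. norm z = r \<and> summable (\<lambda>n. fps_nth F n * z ^ n)"
      using s[of "of_real r"] by (intro exI[of _ "of_real r"]) (auto simp: summable_def)
  qed
  moreover have "eval_fps F q = G q" if "0 < norm q \<and> norm q < 1" for q
    using s[of q] that by (simp add: eval_fps_def sums_iff)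
  ultimately show ?thesis using assms(1) by (auto simp: int_series_def)
qed

lemma int_series_unique:
  assumes "int_series F G" "int_series F' G"
  shows "F = F'"
proof -
  have *: "ereal (norm z) < fps_conv_radius F \<and> ereal (norm z) < fps_conv_radius F'"
    if "norm z < 1" for z :: complex
    using assms that by (auto simp: int_series_def intro: less_le_trans[of _ 1])
  \<comment> \<open>The factor \<open>fps_X\<close> makes both sides vanish at 0, so they agree on
    the whole disc although the values of \<open>F\<close> and \<open>F'\<close> at 0 are not yet
    compared.\<close>
  have "fps_X * F = fps_X * F'"
  proof (rule eval_fps_eqD)
    have "1 \<le> fps_conv_radius (fps_X * f)" if "1 \<le> fps_conv_radius f" for f :: "complex fps"
      using fps_conv_radius_mult[of fps_X f] that by (auto intro: order_trans)
    thus "fps_conv_radius (fps_X * F) > 0" "fps_conv_radius (fps_X * F') > 0"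
      using assms less_le_trans[of 0 "1::ereal"] by (auto simp: int_series_def)
    have "eventually (\<lambda>z. z \<in> ball 0 1) (nhds (0::complex))"
      by (intro eventually_nhds_in_open) auto
    thus "eventually (\<lambda>z. eval_fps (fps_X * F) z = eval_fps (fps_X * F') z) (nhds 0)"
    proof eventually_elim
      case (elim z)
      show ?case
      proof (cases "z = 0")
        case False
        hence "eval_fps F z = eval_fps F' z"
          using elim assms by (simp add: int_series_def)
        thus ?thesis using elim * by (simp add: eval_fps_mult)
      qed (simp add: eval_fps_at_0)
    qed
  qed
  thus ?thesis by simp
qed

lemma int_series_mult:
  assumes "int_series F G" "int_series F' G'"
  shows "int_series (F * F') (\<lambda>q. G q * G' q)"
  unfolding int_series_def
proof (intro conjI allI impI)
  show "1 \<le> fps_conv_radius (F * F')"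
    using assms by (intro order_trans[OF _ fps_conv_radius_mult]) (auto simp: int_series_def)
  show "fps_nth (F * F') n \<in> \<int>" for n
    using assms by (auto simp: int_series_def fps_mult_nth)
  show "eval_fps (F * F') q = G q * G' q" if "0 < norm q \<and> norm q < 1" for q
    using assms that
    by (subst eval_fps_mult) (auto simp: int_series_def intro: less_le_trans[of _ 1])
qed

lemma int_series_add:
  assumes "int_series F G" "int_series F' G'"
  shows "int_series (F + F') (\<lambda>q. G q + G' q)"
  unfolding int_series_def
proof (intro conjI allI impI)
  show "1 \<le> fps_conv_radius (F + F')"
    using assms by (intro order_trans[OF _ fps_conv_radius_add]) (auto simp: int_series_def)
  show "fps_nth (F + F') n \<in> \<int>" for n
    using assms by (auto simp: int_series_def)
  show "eval_fps (F + F') q = G q + G' q" if "0 < norm q \<and> norm q < 1" for q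
    using assms that
    by (subst eval_fps_add) (auto simp: int_series_def intro: less_le_trans[of _ 1])
qed

lemma int_series_cong:
  assumes "int_series F G" "\<And>q. 0 < norm q \<Longrightarrow> norm q < 1 \<Longrightarrow> G q = G' q"
  shows "int_series F G'"
  using assms by (simp add: int_series_def)

text \<open>In the convolution identity for \<open>F * inverse F = 1\<close> the top coefficient of
  \<open>inverse F\<close> is multiplied by the constant term 1, so solving for it involves no
  division and strong induction applies.\<close>

lemma inverse_fps_Ints:
  fixes F :: "'a :: field_char_0 fps"
  assumes "\<And>n. fps_nth F n \<in> \<int>" "fps_nth F 0 = 1"
  shows "fps_nth (inverse F) n \<in> \<int>"
proof (induction n rule: less_induct)
  case (less n)
  show ?case
  proof (cases "n = 0")
    case False
    have "F * inverse F = 1"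
      using assms by (simp add: inverse_mult_eq_1')
    hence "(\<Sum>i=0..n. fps_nth F i * fps_nth (inverse F) (n - i)) = 0"
      using False by (metis fps_mult_nth fps_one_nth)
    hence "fps_nth (inverse F) n = - (\<Sum>i=1..n. fps_nth F i * fps_nth (inverse F) (n - i))"
      using assms by (simp add: sum.atLeast_Suc_atMost eq_neg_iff_add_eq_0)
    also have "\<dots> \<in> \<int>"
      using less False assms by (intro Ints_minus Ints_sum Ints_mult) auto
    finally show ?thesis .
  qed (use assms in simp)
qed

lemma int_series_inverse:
  assumes "int_series F G" "fps_nth F 0 = 1"
    and nz: "\<And>q. 0 < norm q \<Longrightarrow> norm q < 1 \<Longrightarrow> G q \<noteq> 0"
  shows "int_series (inverse F) (\<lambda>q. inverse (G q))"
proof -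
  \<comment> \<open>At 0 the value is the constant coefficient 1, elsewhere it is
    \<open>G z\<close>. Since \<open>F\<close> has no zero in the unit disc, its reciprocal
    converges there too.\<close>
  have nz': "eval_fps F z \<noteq> 0" if "ereal (norm z) < 1" for z
    using assms that by (cases "z = 0") (auto simp: int_series_def eval_fps_at_0)
  show ?thesis unfolding int_series_def
  proof (intro conjI allI impI)
    show "1 \<le> fps_conv_radius (inverse F)"
      using fps_conv_radius_inverse[of 1, OF nz'] assms
      by (auto simp: int_series_def min_def split: if_splits)
    show "fps_nth (inverse F) n \<in> \<int>" for n
      using assms by (intro inverse_fps_Ints) (auto simp: int_series_def)
    show "eval_fps (inverse F) q = inverse (G q)" if "0 < norm q \<and> norm q < 1" for q
      using assms that
      by (subst eval_fps_inverse[where r = 1, OF nz']) (auto simp: int_series_def intro: less_le_trans[of _ 1])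
  qed
qed

text \<open>The sum of all \<open>w i * q ^ e i\<close>, collected by exponent. A fibre of
  \<open>e\<close> may be infinite; its sum is taken in the discrete space of integers, where
  summability means that only finitely many weights are nonzero.\<close>

definition family_fps :: "'i set \<Rightarrow> ('i \<Rightarrow> int) \<Rightarrow> ('i \<Rightarrow> nat) \<Rightarrow> complex fps" where
  "family_fps I w e = Abs_fps (\<lambda>n. of_int (\<Sum>\<^sub>\<infinity>i\<in>{i\<in>I. e i = n}. w i))"

lemma int_series_family:
  fixes w :: "'i \<Rightarrow> int" and e :: "'i \<Rightarrow> nat"
  assumes sm: "\<And>q::complex. 0 < norm q \<Longrightarrow> norm q < 1 \<Longrightarrow>
                 ((\<lambda>i. of_int (w i) * q ^ e i) has_sum G q) I"
  shows "int_series (family_fps I w e) G"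
proof -
  define F where "F = family_fps I w e"
  have s: "(\<lambda>n. fps_nth F n * q ^ n) sums G q" if q: "0 < norm q" "norm q < 1" for q
  proof -
    let ?B = "\<lambda>n. {i\<in>I. e i = n}"
    have "((\<lambda>i. of_int (w i) * q ^ e i) has_sum G q) I \<longleftrightarrow>
          ((\<lambda>(n,i). of_int (w i) * q ^ n) has_sum G q) (Sigma UNIV ?B)"
      by (rule has_sum_reindex_bij_witness[of _ snd "\<lambda>i. (e i, i)"]) auto
    hence 1: "((\<lambda>(n,i). of_int (w i) * q ^ n) has_sum G q) (Sigma UNIV ?B)"
      using sm[OF q] by simp
    have "((\<lambda>n. fps_nth F n * q ^ n) has_sum G q) UNIV"
    proof (rule has_sum_SigmaD[OF 1])
      fix n :: nat
      have "(\<lambda>i. of_int (w i) * q ^ n) summable_on ?B n"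
        using summable_on_SigmaD1[OF has_sum_imp_summable[OF 1], of n] by simp
      \<comment> \<open>On a fibre the power of q is a nonzero constant and can be cancelled, so
        convergence at a single q already makes the weights summable.\<close>
      hence "(\<lambda>i. of_int (w i) :: complex) summable_on ?B n"
        using q by (subst (asm) summable_on_cmult_left') auto
      hence "((\<lambda>i. of_int (w i) :: complex) has_sum fps_nth F n) (?B n)"
        by (simp add: F_def family_fps_def infsum_of_int[symmetric] del: infsum_of_int)
      thus "((\<lambda>i. case (n, i) of (n, i) \<Rightarrow> of_int (w i) * q ^ n) has_sum fps_nth F n * q ^ n) (?B n)"
        by (auto intro: has_sum_cmult_left)
    qed
    thus ?thesis by (rule has_sum_imp_sums)
  qed
  have "int_series F G" by (rule int_seriesI) (use s in \<open>auto simp: F_def family_fps_def\<close>)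
  thus ?thesis by (simp add: F_def)
qed

lemma family_fps_nth_eq_0:
  "(\<And>i. i \<in> I \<Longrightarrow> e i \<noteq> n) \<Longrightarrow> fps_nth (family_fps I w e) n = 0"
  unfolding family_fps_def by (auto intro!: infsum_0)

text \<open>A summable family of integers has only finitely many nonzero members, which reduces the
  claim to a finite sum; otherwise \<open>infsum\<close> is 0 by default.\<close>

lemma dvd_infsum_int:
  fixes w :: "'i \<Rightarrow> int"
  assumes "\<And>i. i \<in> A \<Longrightarrow> d dvd w i"
  shows "d dvd infsum w A"
proof (cases "w summable_on A")
  case True
  hence fin: "finite {i\<in>A. w i \<noteq> 0}" by (simp add: summable_on_discrete_iff)
  have "infsum w A = infsum w {i\<in>A. w i \<noteq> 0}" by (rule infsum_cong_neutral) auto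
  also have "\<dots> = sum w {i\<in>A. w i \<noteq> 0}" using fin by (rule infsum_finite)
  also have "d dvd \<dots>" using assms by (intro dvd_sum) auto
  finally show ?thesis .
qed (simp add: infsum_not_exists)

section \<open>Sums over integers and pairs of integers\<close>

lemma abs_summable_on_int:
  fixes f :: "int \<Rightarrow> 'a :: banach"
  assumes "summable (\<lambda>n. norm (f (int n)))" "summable (\<lambda>n. norm (f (- 1 - int n)))"
  shows "(\<lambda>n. norm (f n)) summable_on UNIV"
proof -
  have "(\<lambda>x. norm (f x)) summable_on (range int \<union> range (\<lambda>n. - 1 - int n))"
  proof (rule summable_on_union)
    show "(\<lambda>x. norm (f x)) summable_on range int"
      using assms(1) by (subst summable_on_reindex)
        (auto simp: o_def inj_on_def intro!: norm_summable_imp_summable_on)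
    show "(\<lambda>x. norm (f x)) summable_on range (\<lambda>n. - 1 - int n)"
      using assms(2) by (subst summable_on_reindex)
        (auto simp: o_def inj_on_def intro!: norm_summable_imp_summable_on)
  qed
  also have "range int \<union> range (\<lambda>n. - 1 - int n) = UNIV"
  proof -
    have "x \<in> range int \<union> range (\<lambda>n. - 1 - int n)" for x :: int
      by (cases x rule: int_cases) (auto intro!: image_eqI[of _ _ "nat (-1-x)"])
    thus ?thesis by blast
  qed
  finally show ?thesis .
qed

text \<open>
  The factor \<open>1 / (1 - z)\<close> of the \<open>n\<close>-th summand of a Lambert-type series is expanded in powers of
  \<open>z\<close> for \<open>n \<ge> 0\<close> and in powers of \<open>1 / z\<close> for \<open>n < 0\<close>; \<open>half n\<close> is the set of exponents that occur
  and \<open>hsgn n\<close> the common sign.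
\<close>

definition half :: "int \<Rightarrow> int set" where
  "half n = {k. 0 \<le> k \<longleftrightarrow> 0 \<le> n}"

definition hsgn :: "int \<Rightarrow> int" where
  "hsgn n = (if 0 \<le> n then 1 else - 1)"

lemma has_sum_half_geometric:
  fixes z :: complex
  assumes "0 \<le> n \<Longrightarrow> norm z < 1" "n < 0 \<Longrightarrow> norm z > 1"
  shows "((\<lambda>k. of_int (hsgn n) * z powi k) has_sum 1 / (1 - z)) (half n)"
proof (cases "0 \<le> n")
  case True
  have "((\<lambda>k. z ^ k) has_sum 1 / (1 - z)) UNIV"
    using assms True by (intro norm_summable_imp_has_sum geometric_sums)
      (auto simp: norm_power intro!: summable_geometric)
  also have "?this \<longleftrightarrow> ?thesis"
    by (rule has_sum_reindex_bij_witness[of _ nat int]) (use True in \<open>auto simp: half_def hsgn_def\<close>)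
  finally show ?thesis .
next
  case False
  hence z: "norm z > 1" using assms by simp
  hence [simp]: "z \<noteq> 0" "z \<noteq> 1" by auto
  have "((\<lambda>k. (inverse z) ^ k) has_sum (inverse z / (1 - inverse z))) {1..}"
    using z by (intro has_sum_geometric_from_1) (auto simp: norm_inverse norm_divide field_simps)
  hence "((\<lambda>k. - ((inverse z) ^ k)) has_sum - (inverse z / (1 - inverse z))) {1..}"
    by (rule has_sum_uminusI)
  also have "- (inverse z / (1 - inverse z)) = 1 / (1 - z)"
    by (simp add: field_simps)
  also have "((\<lambda>k. - ((inverse z) ^ k)) has_sum 1 / (1 - z)) {1..} \<longleftrightarrow> ?thesis"
    by (rule has_sum_reindex_bij_witness[of _ "\<lambda>k. nat (- k)" "\<lambda>k. - int k"])
       (use False in \<open>auto simp: half_def hsgn_def power_int_minus power_inverse\<close>)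
  finally show ?thesis .
qed

lemma summable_on_product_nonneg:
  fixes u :: "'a \<Rightarrow> real" and v :: "'b \<Rightarrow> real"
  assumes "u summable_on A" "v summable_on B" "\<And>n. 0 \<le> u n" "\<And>n. 0 \<le> v n"
  shows "(\<lambda>(a,b). u a * v b) summable_on A \<times> B"
  using assms
  by (intro summable_on_SigmaI[where g = "\<lambda>a. u a * infsum v B"])
     (auto intro!: has_sum_cmult_right summable_on_cmult_left)

lemma has_sum_product:
  fixes f :: "'a \<Rightarrow> complex" and g :: "'b \<Rightarrow> complex"
  assumes "(f has_sum F) A" "(g has_sum G) B"
  shows "((\<lambda>(a,b). f a * g b) has_sum F * G) (A \<times> B)"
proof (rule has_sum_SigmaI)
  show "((\<lambda>b. case (a, b) of (a, b) \<Rightarrow> f a * g b) has_sum f a * G) B" for a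
    using has_sum_cmult_right[OF assms(2), of "f a"] by simp
  show "((\<lambda>a. f a * G) has_sum F * G) A"
    by (rule has_sum_cmult_left[OF assms(1)])
  \<comment> \<open>Summable families of complex numbers are absolutely summable, hence so is the
    family of products.\<close>
  have "(\<lambda>a. norm (f a)) summable_on A" "(\<lambda>b. norm (g b)) summable_on B"
    using assms[THEN has_sum_imp_summable] by (simp_all flip: summable_on_iff_abs_summable_on_complex)
  from summable_on_product_nonneg[OF this]
  have "(\<lambda>x. norm (case x of (a, b) \<Rightarrow> f a * g b)) summable_on A \<times> B"
    by (simp add: case_prod_unfold norm_mult)
  thus "(\<lambda>(a,b). f a * g b) summable_on A \<times> B"
    by (rule abs_summable_summable)
qed

text \<open>The index set is the union of the quadrant of nonnegative pairs and the quadrant of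
  negative pairs. Each is parametrised by pairs of naturals and dominated by a product of two
  convergent series.\<close>

lemma abs_summable_on_half:
  fixes f :: "int \<times> int \<Rightarrow> complex"
  assumes uv: "summable u" "summable v" "\<And>n. 0 \<le> u n" "\<And>n. 0 \<le> v n"
    and uv': "summable u'" "summable v'" "\<And>n. 0 \<le> u' n" "\<And>n. 0 \<le> v' n"
    and b: "\<And>a b. norm (f (int a, int b)) \<le> u a * v b"
    and b': "\<And>a b. norm (f (- 1 - int a, - 1 - int b)) \<le> u' a * v' b"
  shows "(\<lambda>x. norm (f x)) summable_on Sigma UNIV half"
proof -
  let ?g = "\<lambda>(a,b). (int a, int b)" and ?h = "\<lambda>(a,b). (- 1 - int a, - 1 - int b)"
  have *: "(\<lambda>(a,b). u a * v b) summable_on UNIV"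
    if "summable u" "summable v" "\<And>n. 0 \<le> u n" "\<And>n. 0 \<le> v n" for u v :: "nat \<Rightarrow> real"
    using summable_on_product_nonneg[of u UNIV v UNIV] that
    by (simp add: summable_on_UNIV_nonneg_real_iff)
  have "(\<lambda>x. norm (f x)) summable_on (range ?g \<union> range ?h)"
  proof (rule summable_on_union)
    show "(\<lambda>x. norm (f x)) summable_on range ?g"
    proof (subst summable_on_reindex)
      show "(\<lambda>x. norm (f x)) \<circ> ?g summable_on UNIV"
        by (rule summable_on_comparison_test[OF *[OF uv]]) (auto simp: b)
    qed (auto simp: inj_on_def)
    show "(\<lambda>x. norm (f x)) summable_on range ?h"
    proof (subst summable_on_reindex)
      show "(\<lambda>x. norm (f x)) \<circ> ?h summable_on UNIV"
        by (rule summable_on_comparison_test[OF *[OF uv']]) (auto simp: b')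
    qed (auto simp: inj_on_def)
  qed
  moreover have "Sigma UNIV half \<subseteq> range ?g \<union> range ?h"
  proof safe
    fix n k assume k: "k \<in> half n" and "(n, k) \<notin> range ?h"
    moreover have "(n, k) = ?h (nat (- 1 - n), nat (- 1 - k))" if "n < 0"
      using k that by (auto simp: half_def)
    moreover have "(n, k) = ?g (nat n, nat k)" if "0 \<le> n"
      using k that by (auto simp: half_def)
    ultimately show "(n, k) \<in> range ?g" by (metis not_le rangeI)
  qed
  ultimately show ?thesis by (rule summable_on_subset)
qed

section \<open>The Jacobi triple product\<close>

definition tri :: "int \<Rightarrow> int" where
  "tri n = n * (n - 1) div 2"

lemma two_tri: "2 * tri n = n * (n - 1)"
  unfolding tri_def by (rule dvd_mult_div_cancel) (simp)

lemma tri_add_1: "tri (n + 1) = tri n + n"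
proof -
  have "2 * tri (n + 1) = 2 * (tri n + n)"
    unfolding distrib_left two_tri by (simp add: algebra_simps)
  thus ?thesis by simp
qed

lemma tri_minus_1: "tri (n - 1) = tri n - n + 1"
  using tri_add_1[of "n - 1"] by simp

section \<open>Central q-binomial coefficients and the finite triple product\<close>

definition qfac :: "complex \<Rightarrow> nat \<Rightarrow> complex" where
  "qfac q n = (\<Prod>k<n. 1 - q ^ Suc k)"

lemma qfac_Suc: "qfac q (Suc n) = qfac q n * (1 - q ^ Suc n)"
  by (simp add: qfac_def)

lemma power_ne_1: "norm (q :: complex) < 1 \<Longrightarrow> q ^ Suc k \<noteq> 1"
  by (metis norm_one norm_power power_Suc_less_one norm_ge_zero less_irrefl
      power_less_one_iff zero_less_Suc)

lemma qfac_nonzero: "norm q < 1 \<Longrightarrow> qfac q n \<noteq> 0"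
  unfolding qfac_def using power_ne_1 by (auto simp del: power_Suc)

text \<open>The central \<open>q\<close>-binomial coefficient \<open>[2n, n + m]\<close>.\<close>

definition cbin :: "complex \<Rightarrow> nat \<Rightarrow> int \<Rightarrow> complex" where
  "cbin q n m = (if \<bar>m\<bar> \<le> int n then
     qfac q (2 * n) / (qfac q (nat (int n - m)) * qfac q (nat (int n + m))) else 0)"

lemma qfac_nat: "0 < m \<Longrightarrow> qfac q (nat m) = qfac q (nat (m - 1)) * (1 - q powi m)"
  using qfac_Suc[of q "nat (m - 1)"]
  by (cases m) (auto simp: Suc_diff_1 nat_diff_distrib power_int_def Suc_nat_eq_nat_zadd1)

text \<open>This lemma and the next ones clear the common denominator of level n + 1. At the border,
  where \<open>cbin\<close> is 0 by definition, one of the factors on the right vanishes, so no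
  exception arises.\<close>

lemma cbin_mid:
  assumes "norm q < 1" "\<bar>m\<bar> \<le> int n + 1"
  shows "cbin q n m * (qfac q (nat (int n + 1 - m)) * qfac q (nat (int n + 1 + m))) =
         qfac q (2 * n) * (1 - q powi (int n + 1 - m)) * (1 - q powi (int n + 1 + m))"
proof (cases "\<bar>m\<bar> \<le> int n")
  case True
  have "qfac q (nat (int n + 1 - m)) = qfac q (nat (int n - m)) * (1 - q powi (int n + 1 - m))"
       "qfac q (nat (int n + 1 + m)) = qfac q (nat (int n + m)) * (1 - q powi (int n + 1 + m))"
    using True by (subst qfac_nat; simp)+
  thus ?thesis using True by (simp add: cbin_def qfac_nonzero assms)
next
  case False
  hence "m = int n + 1 \<or> m = - (int n + 1)" using assms by linarith
  thus ?thesis using False by (auto simp: cbin_def)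
qed

lemma cbin_low:
  assumes "norm q < 1" "q \<noteq> 0" "\<bar>m\<bar> \<le> int n + 1"
  shows "cbin q n (m - 1) * (qfac q (nat (int n + 1 - m)) * qfac q (nat (int n + 1 + m))) =
         qfac q (2 * n) * (1 - q powi (int n + m)) * (1 - q powi (int n + m + 1))"
proof (cases "\<bar>m - 1\<bar> \<le> int n")
  case True
  have "qfac q (nat (int n + 1 + m)) = qfac q (nat (int n + m)) * (1 - q powi (int n + m + 1))"
    using True by (subst qfac_nat) (auto simp: algebra_simps)
  moreover have "qfac q (nat (int n + m)) = qfac q (nat (int n + (m - 1))) * (1 - q powi (int n + m))"
    using True by (subst qfac_nat) (auto simp: algebra_simps)
  moreover have e: "qfac q (nat (int n - (m - 1))) = qfac q (nat (int n + 1 - m))"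
    by (simp add: algebra_simps)
  ultimately show ?thesis using True by (simp add: cbin_def qfac_nonzero assms e)
next
  case False
  hence "m = - int n \<or> m = - (int n + 1)" using assms by linarith
  thus ?thesis using False by (auto simp: cbin_def)
qed

lemma cbin_uminus: "cbin q n (- m) = cbin q n m"
  by (simp add: cbin_def mult.commute)

lemma cbin_high:
  assumes "norm q < 1" "q \<noteq> 0" "\<bar>m\<bar> \<le> int n + 1"
  shows "cbin q n (m + 1) * (qfac q (nat (int n + 1 - m)) * qfac q (nat (int n + 1 + m))) =
         qfac q (2 * n) * (1 - q powi (int n - m)) * (1 - q powi (int n - m + 1))"
  using cbin_low[of q "- m" n] assms cbin_uminus[of q n "m + 1"] by (simp add: mult.commute)

text \<open>The three neighbours on the right are what multiplication by the next pair of factors of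
  the finite triple product produces. With denominators cleared, the recurrence is a polynomial
  identity in q, \<open>u\<close> and \<open>v\<close>.\<close>

lemma cbin_Suc:
  assumes "norm q < 1" "q \<noteq> 0"
  shows "cbin q (Suc n) m = (1 + q ^ (2 * n + 1)) * cbin q n m
           + q powi (int n - m + 1) * cbin q n (m - 1) + q powi (int n + m + 1) * cbin q n (m + 1)"
proof (cases "\<bar>m\<bar> \<le> int n + 1")
  case False
  thus ?thesis by (auto simp: cbin_def)
next
  case True
  define d where "d = qfac q (nat (int n + 1 - m)) * qfac q (nat (int n + 1 + m))"
  define u v where "u = q powi (int n - m)" and "v = q powi (int n + m)"
  have d: "d \<noteq> 0" by (simp add: d_def qfac_nonzero assms)
  have uv: "u * v = q ^ (2 * n)"
    using assms by (simp add: u_def v_def flip: power_int_add) (simp add: power_int_def nat_mult_distrib)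
  have pw: "q powi (int n + 1 - m) = q * u" "q powi (int n + 1 + m) = q * v"
       "q powi (int n + m + 1) = q * v" "q powi (int n - m + 1) = q * u"
    using assms by (simp_all add: u_def v_def power_int_add power_int_diff field_simps)
  have "cbin q (Suc n) m * d = qfac q (2 * Suc n)"
    using True d by (simp add: cbin_def d_def algebra_simps)
  also have "\<dots> = qfac q (2 * n) * (1 - q * (u * v)) * (1 - q * q * (u * v))"
    by (simp add: qfac_Suc uv algebra_simps)
  also have "\<dots> = (1 + q * (u * v)) * (qfac q (2 * n) * (1 - q * u) * (1 - q * v))
      + q * u * (qfac q (2 * n) * (1 - v) * (1 - q * v)) + q * v * (qfac q (2 * n) * (1 - u) * (1 - q * u))"
    by algebra
  also have "\<dots> = (1 + q * (u * v)) * (cbin q n m * d)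
      + q * u * (cbin q n (m - 1) * d) + q * v * (cbin q n (m + 1) * d)"
    using cbin_mid[OF assms(1) True] cbin_low[OF assms True] cbin_high[OF assms True]
    unfolding d_def[symmetric] pw unfolding u_def[symmetric] v_def[symmetric] by simp
  also have "\<dots> = ((1 + q ^ (2 * n + 1)) * cbin q n m + q powi (int n - m + 1) * cbin q n (m - 1)
      + q powi (int n + m + 1) * cbin q n (m + 1)) * d"
    unfolding pw by (simp add: uv algebra_simps)
  finally show ?thesis using d by simp
qed

definition theta_term :: "complex \<Rightarrow> complex \<Rightarrow> int \<Rightarrow> complex" where
  "theta_term x q n = (- 1) powi n * q powi tri n * x powi n"

lemma theta_term_minus_1:
  "x \<noteq> 0 \<Longrightarrow> q \<noteq> 0 \<Longrightarrow> x * q ^ n * theta_term x q (m - 1) = - (q powi (int n - m + 1) * theta_term x q m)"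
  by (simp add: theta_term_def tri_minus_1 power_int_add power_int_diff field_simps)

lemma theta_term_plus_1:
  "x \<noteq> 0 \<Longrightarrow> q \<noteq> 0 \<Longrightarrow> q ^ Suc n / x * theta_term x q (m + 1) = - (q powi (int n + m + 1) * theta_term x q m)"
  unfolding theta_term_def tri_add_1 by (simp add: power_int_add power_int_diff field_simps)

lemma has_sum_int_shift:
  "((\<lambda>n::int. f (n + a)) has_sum s) UNIV \<longleftrightarrow> (f has_sum s) UNIV"
  by (rule has_sum_reindex_bij_witness[of _ "\<lambda>n. n - a" "\<lambda>n. n + a"]) auto

text \<open>The new factors (1 - x q^n) (1 - q^(n+1) / x) expand to 1 + q^(2n+1) - x q^n - q^(n+1) /
  x. Shifting the summation index in the last two contributions gives the right-hand side of
  \<open>cbin_Suc\<close>.\<close>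

lemma finite_jacobi_triple:
  assumes "norm q < 1" "q \<noteq> 0" "x \<noteq> 0"
  shows "((\<lambda>m. cbin q n m * theta_term x q m) has_sum
            (\<Prod>k<n. (1 - x * q ^ k) * (1 - q / x * q ^ k))) UNIV"
proof (induction n)
  case 0
  have "((\<lambda>m. cbin q 0 m * theta_term x q m) has_sum 1) UNIV"
    by (rule has_sum_finite_neutralI[of "{0}"])
       (auto simp: cbin_def qfac_def theta_term_def tri_def)
  thus ?case by simp
next
  case (Suc n)
  let ?P = "\<Prod>k<n. (1 - x * q ^ k) * (1 - q / x * q ^ k)"
  let ?T = "theta_term x q"
  note IH = Suc.IH
  have 1: "((\<lambda>m. x * q ^ n * (cbin q n (m - 1) * ?T (m - 1))) has_sum x * q ^ n * ?P) UNIV"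
    using has_sum_int_shift[of "\<lambda>m. cbin q n m * ?T m" "-1"] IH
    by (intro has_sum_cmult_right) simp
  have 2: "((\<lambda>m. q ^ Suc n / x * (cbin q n (m + 1) * ?T (m + 1))) has_sum q ^ Suc n / x * ?P) UNIV"
    using has_sum_int_shift[of "\<lambda>m. cbin q n m * ?T m" "1"] IH
    by (intro has_sum_cmult_right) simp
  have "((\<lambda>m. (1 + q ^ (2 * n + 1)) * (cbin q n m * ?T m)
           + (- (x * q ^ n * (cbin q n (m - 1) * ?T (m - 1)))
              + - (q ^ Suc n / x * (cbin q n (m + 1) * ?T (m + 1))))) has_sum
         ((1 + q ^ (2 * n + 1)) * ?P + (- (x * q ^ n * ?P) + - (q ^ Suc n / x * ?P)))) UNIV"
    by (intro has_sum_add has_sum_uminusI 1 2 has_sum_cmult_right IH)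
  also have "(1 + q ^ (2 * n + 1)) * ?P + (- (x * q ^ n * ?P) + - (q ^ Suc n / x * ?P)) =
             (\<Prod>k<Suc n. (1 - x * q ^ k) * (1 - q / x * q ^ k))"
    using assms by (simp add: field_simps power_add mult_2 mult_2_right)
  also have "(\<lambda>m. (1 + q ^ (2 * n + 1)) * (cbin q n m * ?T m)
           + (- (x * q ^ n * (cbin q n (m - 1) * ?T (m - 1)))
              + - (q ^ Suc n / x * (cbin q n (m + 1) * ?T (m + 1))))) =
        (\<lambda>m. cbin q (Suc n) m * ?T m)"
  proof
    fix m
    have "x * q ^ n * (cbin q n (m - 1) * ?T (m - 1)) = cbin q n (m - 1) * (x * q ^ n * ?T (m - 1))"
      by simp
    moreover have "q ^ Suc n / x * (cbin q n (m + 1) * ?T (m + 1)) =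
        cbin q n (m + 1) * (q ^ Suc n / x * ?T (m + 1))"
      by simp
    ultimately show "(1 + q ^ (2 * n + 1)) * (cbin q n m * ?T m)
           + (- (x * q ^ n * (cbin q n (m - 1) * ?T (m - 1)))
              + - (q ^ Suc n / x * (cbin q n (m + 1) * ?T (m + 1)))) = cbin q (Suc n) m * ?T m"
      unfolding theta_term_minus_1[OF assms(3,2)] theta_term_plus_1[OF assms(3,2)]
      by (simp only: cbin_Suc[OF assms(1,2)]) (simp only: algebra_simps mult_minus_right minus_minus)
  qed
  finally show ?case .
qed

section \<open>Infinite products and the passage to the limit\<close>

lemma convergent_prod_qpoch:
  assumes "norm (q::complex) < 1"
  shows "convergent_prod (\<lambda>k. 1 - a * q ^ k)"
proof -
  have "summable (\<lambda>k. norm (a * q ^ k))"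
    using assms by (auto simp: norm_mult norm_power intro!: summable_mult summable_geometric)
  thus ?thesis
    by (intro abs_convergent_prod_imp_convergent_prod summable_imp_abs_convergent_prod) simp
qed

lemma qpoch_inf_tendsto:
  assumes "norm q < 1"
  shows "(\<lambda>n. \<Prod>k<n. 1 - a * q ^ k) \<longlonglongrightarrow> qpoch_inf a q"
  unfolding qpoch_inf_def
  by (rule has_prod_imp_tendsto'[OF convergent_prod_has_prod[OF convergent_prod_qpoch[OF assms]]])

lemma qpoch_inf_nonzero:
  assumes "norm q < 1" "norm a < 1"
  shows "qpoch_inf a q \<noteq> 0"
  unfolding qpoch_inf_def
proof (rule prodinf_nonzero[OF convergent_prod_qpoch[OF assms(1)]])
  fix k
  have "norm a * norm q ^ k \<le> norm a"
    using assms by (intro mult_left_le power_le_one) auto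
  hence "norm (a * q ^ k) < 1"
    using assms by (simp add: norm_mult norm_power)
  thus "1 - a * q ^ k \<noteq> 0" by auto
qed

lemma qfac_tendsto: "norm q < 1 \<Longrightarrow> qfac q \<longlonglongrightarrow> qpoch_inf q q"
  using qpoch_inf_tendsto[of q q] by (simp add: qfac_def[abs_def])

lemma summable_n_power:
  fixes r :: real
  assumes "0 \<le> r" "r < 1"
  shows "summable (\<lambda>n. of_nat (Suc n) * r ^ n)"
  using geometric_deriv_sums[of r] assms by (auto simp: sums_iff)

lemma tri_int_ge: "tri (int n) \<ge> 0" "tri (- int n) \<ge> int n"
proof -
  show "tri (int n) \<ge> 0" by (cases n) (auto simp: tri_def intro!: pos_imp_zdiv_nonneg_iff[THEN iffD2])
  have "0 \<le> int n * (int n - 1)" by (cases n) auto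
  hence "2 * int n \<le> 2 * tri (- int n)" unfolding two_tri by (simp add: algebra_simps)
  thus "tri (- int n) \<ge> int n" by simp
qed

lemma norm_powi_mono:
  assumes "norm (q::complex) \<le> 1" "q \<noteq> 0" "a \<le> b"
  shows "norm (q powi b) \<le> norm (q powi a)"
  using assms power_int_decreasing[of a b "norm q"] by (auto simp: norm_power_int)

text \<open>Only \<open>tri n >= 0\<close> and \<open>tri (- n) >= n\<close> for natural n are used;
  these crude bounds already give geometric majorants that converge for norm q < norm x < 1.\<close>

lemma theta_term_bounds:
  assumes "norm q < 1" "q \<noteq> 0" "x \<noteq> 0"
  shows "norm (theta_term x q (int n)) \<le> norm x ^ n"
    and "norm (theta_term x q (- int n)) \<le> (norm q / norm x) ^ n"
proof -
  have "norm (q powi tri (int n)) \<le> 1"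
    using norm_powi_mono[of q 0 "tri (int n)"] tri_int_ge[of n] assms by simp
  thus "norm (theta_term x q (int n)) \<le> norm x ^ n"
    by (simp add: theta_term_def norm_mult norm_power_int norm_power mult_left_le_one_le)
  have "norm (q powi tri (- int n)) \<le> norm q ^ n"
    using norm_powi_mono[of q "int n" "tri (- int n)"] tri_int_ge[of n] assms
    by (simp add: norm_power)
  hence "norm (q powi tri (- int n)) / norm x ^ n \<le> norm q ^ n / norm x ^ n"
    by (rule divide_right_mono) simp
  moreover have "norm (theta_term x q (- int n)) = norm (q powi tri (- int n)) / norm x ^ n"
    unfolding theta_term_def power_int_minus power_int_of_nat norm_mult norm_inverse norm_power
    by (simp add: divide_inverse)
  ultimately show "norm (theta_term x q (- int n)) \<le> (norm q / norm x) ^ n"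
    by (simp add: power_divide)
qed

lemma theta_summable:
  assumes "q \<noteq> 0" "norm q < norm x" "norm x < 1"
  shows "summable (\<lambda>n. norm (theta_term x q (int n)))"
    "summable (\<lambda>n. norm (theta_term x q (- 1 - int n)))"
proof -
  have [simp]: "x \<noteq> 0" using assms by auto
  have q: "norm q < 1" using assms by simp
  show "summable (\<lambda>n. norm (theta_term x q (int n)))"
  proof (rule summable_comparison_test'[of "\<lambda>n. norm x ^ n" 0])
    show "summable (\<lambda>n. norm x ^ n)" using assms by (simp add: summable_geometric)
    show "norm (norm (theta_term x q (int n))) \<le> norm x ^ n" for n
      using theta_term_bounds(1)[OF q assms(1), of x n] by simp
  qed
  show "summable (\<lambda>n. norm (theta_term x q (- 1 - int n)))"
  proof (rule summable_comparison_test'[of "\<lambda>n. norm q / norm x * (norm q / norm x) ^ n" 0])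
    show "summable (\<lambda>n. norm q / norm x * (norm q / norm x) ^ n)"
      using assms by (intro summable_mult summable_geometric) simp
    fix n
    have e: "- int (Suc n) = - 1 - int n" by simp
    have "x \<noteq> 0" using assms by auto
    from theta_term_bounds(2)[OF q assms(1) this, of "Suc n", unfolded e power_Suc]
    show "norm (norm (theta_term x q (- 1 - int n))) \<le> norm q / norm x * (norm q / norm x) ^ n"
      by (simp only: real_norm_def abs_norm_cancel)
  qed
qed

text \<open>Pairing k with - 1 - k turns a sum over the integers into a series over the naturals,
  the form in which Tannery's theorem is applied below.\<close>

lemma has_sum_int_imp_sums:
  fixes f :: "int \<Rightarrow> 'a :: banach"
  assumes "(f has_sum s) UNIV"
  shows "(\<lambda>k. f (int k) + f (- 1 - int k)) sums s"
proof -
  have s: "f summable_on {0..}" "f summable_on {..<0}"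
    by (rule summable_on_subset_banach[OF has_sum_imp_summable[OF assms]], simp)+
  have "((\<lambda>k. f (int k)) has_sum infsum f {0..}) UNIV \<longleftrightarrow> (f has_sum infsum f {0..}) {0..}"
    by (rule has_sum_reindex_bij_witness[of _ nat int]) auto
  hence c1: "((\<lambda>k. f (int k)) has_sum infsum f {0..}) UNIV"
    using has_sum_infsum s by blast
  have "((\<lambda>k. f (- 1 - int k)) has_sum infsum f {..<0}) UNIV \<longleftrightarrow> (f has_sum infsum f {..<0}) {..<0}"
    by (rule has_sum_reindex_bij_witness[of _ "\<lambda>k. nat (- 1 - k)" "\<lambda>k. - 1 - int k"]) auto
  hence c2: "((\<lambda>k. f (- 1 - int k)) has_sum infsum f {..<0}) UNIV"
    using has_sum_infsum s by blast
  have U: "{0..} \<union> {..<0::int} = UNIV" by auto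
  have "(f has_sum (infsum f {0..} + infsum f {..<0})) ({0..} \<union> {..<0})"
    using s by (intro has_sum_Un_disjoint) auto
  hence sum: "infsum f {0..} + infsum f {..<0} = s"
    unfolding U by (rule has_sum_unique[OF _ assms])
  show ?thesis
    using sums_add[OF has_sum_imp_sums[OF c1] has_sum_imp_sums[OF c2]] by (simp only: sum)
qed

text \<open>Let n tend to infinity in \<open>finite_jacobi_triple\<close>. The coefficients
  \<open>cbin q n m\<close> are bounded uniformly and tend to 1 / (q; q)_inf for fixed m, so
  Tannery's theorem permits the limit term by term.\<close>

theorem jacobi_triple_product:
  assumes "q \<noteq> 0" "norm q < norm x" "norm x < 1"
  shows "(theta_term x q has_sum (qpoch_inf x q * qpoch_inf (q / x) q * qpoch_inf q q)) UNIV"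
proof -
  have q: "norm q < 1" and x: "x \<noteq> 0" using assms by auto
  let ?T = "theta_term x q"
  let ?P = "qpoch_inf q q"
  have Pnz: "?P \<noteq> 0" by (rule qpoch_inf_nonzero[OF q q])
  obtain B where B: "B > 0" "\<And>n. norm (qfac q n) \<le> B"
    using convergent_imp_Bseq[OF convergentI[OF qfac_tendsto[OF q]]] by (auto simp: Bseq_def)
  have "(\<lambda>n. inverse (qfac q n)) \<longlonglongrightarrow> inverse ?P"
    by (intro tendsto_inverse qfac_tendsto q Pnz)
  then obtain B' where B': "B' > 0" "\<And>n. norm (inverse (qfac q n)) \<le> B'"
    using convergent_imp_Bseq[OF convergentI, of "\<lambda>n. inverse (qfac q n)"] by (auto simp: Bseq_def)
  define C where "C = B * (B' * B')"
  have C: "norm (cbin q n m) \<le> C" for n m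
  proof -
    have "norm (qfac q (2 * n)) * (norm (inverse (qfac q i)) * norm (inverse (qfac q j))) \<le> C" for i j
      unfolding C_def using B B' by (intro mult_mono mult_nonneg_nonneg) (auto intro: less_imp_le)
    moreover have "0 \<le> C" using B B' by (simp add: C_def)
    ultimately show ?thesis
      by (auto simp: cbin_def divide_inverse norm_mult)
  qed
  have lim: "(\<lambda>n. cbin q n m) \<longlonglongrightarrow> inverse ?P" for m
  proof -
    have "filterlim (\<lambda>n. nat (int n - m)) sequentially sequentially"
         "filterlim (\<lambda>n. nat (int n + m)) sequentially sequentially"
         "filterlim (\<lambda>n::nat. 2 * n) sequentially sequentially"
      by real_asymp+
    note * = this[THEN filterlim_compose[OF qfac_tendsto[OF q]]]
    have "(\<lambda>n. qfac q (2 * n) / (qfac q (nat (int n - m)) * qfac q (nat (int n + m)))) \<longlonglongrightarrow> ?P / (?P * ?P)"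
      using Pnz by (intro tendsto_divide tendsto_mult *) auto
    also have "?P / (?P * ?P) = inverse ?P" using Pnz by (simp add: field_simps)
    \<comment> \<open>From n = |m| on, \<open>cbin\<close> is given by the quotient and not by its
      default 0.\<close>
    finally show ?thesis
      by (rule Lim_transform_eventually)
         (auto intro!: eventually_mono[OF eventually_ge_at_top[of "nat \<bar>m\<bar>"]] simp: cbin_def)
  qed
  define b where "b = (\<lambda>k. inverse ?P * ?T (int k) + inverse ?P * ?T (- 1 - int k))"
  define a where "a = (\<lambda>k n. cbin q n (int k) * ?T (int k) + cbin q n (- 1 - int k) * ?T (- 1 - int k))"
  define M where "M = (\<lambda>k. C * norm (?T (int k)) + C * norm (?T (- 1 - int k)))"
  have "norm (a k n) \<le> M k" for k n
    unfolding a_def M_def using C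
    by (intro order_trans[OF norm_triangle_ineq] add_mono) (auto simp: norm_mult intro!: mult_right_mono)
  hence "(\<lambda>n. suminf (\<lambda>k. a k n)) \<longlonglongrightarrow> suminf b"
    by (intro tannerys_theorem[where M = M, THEN conjunct2, THEN conjunct2])
       (use theta_summable[OF assms] in \<open>auto simp: M_def a_def b_def case_prod_unfold intro!: tendsto_intros lim summable_add summable_mult\<close>)
  also have "(\<lambda>n. suminf (\<lambda>k. a k n)) = (\<lambda>n. \<Prod>k<n. (1 - x * q ^ k) * (1 - q / x * q ^ k))"
    using has_sum_int_imp_sums[OF finite_jacobi_triple[OF q assms(1) x]]
    by (simp add: a_def sums_iff)
  finally have 1: "(\<lambda>n. \<Prod>k<n. (1 - x * q ^ k) * (1 - q / x * q ^ k)) \<longlonglongrightarrow> suminf b" .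
  have "(\<lambda>n. \<Prod>k<n. (1 - x * q ^ k) * (1 - q / x * q ^ k)) \<longlonglongrightarrow> qpoch_inf x q * qpoch_inf (q / x) q"
    unfolding prod.distrib by (intro tendsto_mult qpoch_inf_tendsto q)
  with 1 have b: "suminf b = qpoch_inf x q * qpoch_inf (q / x) q"
    by (rule LIMSEQ_unique)
  have s: "?T summable_on UNIV"
    using abs_summable_on_int[OF theta_summable[OF assms]] by (rule abs_summable_summable)
  hence "(?T has_sum infsum ?T UNIV) UNIV" by simp
  hence "((\<lambda>m. inverse ?P * ?T m) has_sum inverse ?P * infsum ?T UNIV) UNIV"
    by (rule has_sum_cmult_right)
  from has_sum_int_imp_sums[OF this] have "suminf b = inverse ?P * infsum ?T UNIV"
    by (simp add: b_def sums_iff)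
  with b Pnz have "infsum ?T UNIV = qpoch_inf x q * qpoch_inf (q / x) q * ?P"
    by (simp add: field_simps)
  thus ?thesis using s by (metis has_sum_infsum)
qed

section \<open>The Lerch-Lambert identity\<close>

text \<open>With q^j for \<open>x\<close> and q^p for \<open>q\<close> this is the summand of
  \<open>appell_gf j p\<close>.\<close>

definition lerch_term :: "complex \<Rightarrow> complex \<Rightarrow> int \<Rightarrow> complex" where
  "lerch_term x q n = (- 1) powi n * q powi tri (n + 1) * x powi (n + 1) / (1 - x * q powi n)"

text \<open>The value at m = 0 is 0, so a sum over all integers is in effect a sum over m different
  from 0.\<close>

definition lambert_term :: "complex \<Rightarrow> complex \<Rightarrow> int \<Rightarrow> complex" where
  "lambert_term x q m = of_int m * x powi m / (1 - q powi m)"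

text \<open>These terms sum to minus the coefficient of \<open>x^0\<close> in the Lambert series times the theta series.\<close>

definition const_term :: "complex \<Rightarrow> int \<Rightarrow> complex" where
  "const_term q m = - (of_int m * (- 1) powi m * q powi tri (m + 1) / (1 - q powi m))"

text \<open>By Jacobi, these terms sum to \<open>(q; q)\<^sub>\<infinity>^3\<close>, but this is not needed.\<close>

definition cube_term :: "complex \<Rightarrow> int \<Rightarrow> complex" where
  "cube_term q k = of_int k * (- 1) powi k * q powi tri (k + 1)"

lemma norm_powi_le_power:
  assumes "norm (q::complex) < 1" "q \<noteq> 0" "int c \<le> e"
  shows "norm (q powi e) \<le> norm q ^ c"
  using norm_powi_mono[of q "int c" e] assms by (simp add: norm_power)

text \<open>In this annulus norm (x q^n) is below 1 for n >= 0 and above 1 for n < 0. Hence no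
  denominator of the Lerch sum vanishes and the sign of n selects the geometric expansion.\<close>

locale theta_domain =
  fixes x q :: complex
  assumes q0: "q \<noteq> 0" and qx: "norm q < norm x" and x1: "norm x < 1"
begin

lemma x0: "x \<noteq> 0" and q1: "norm q < 1"
  using qx x1 by auto

abbreviation "\<rho> \<equiv> norm q / norm x"

lemma rho: "0 \<le> \<rho>" "\<rho> < 1"
  using qx by (auto simp: divide_simps)

lemma summable_powers:
  "summable (\<lambda>n. norm x ^ n)" "summable (\<lambda>n. norm q ^ n)" "summable (\<lambda>n. \<rho> ^ n)"
  "summable (\<lambda>n. real (Suc n) * norm x ^ n)" "summable (\<lambda>n. real (Suc n) * norm q ^ n)"
  "summable (\<lambda>n. real (Suc n) * \<rho> ^ n)"
  using rho x1 q1 by (auto intro!: summable_geometric summable_n_power simp del: of_nat_Suc)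

lemma norm_q_powi_le_1: "0 \<le> e \<Longrightarrow> norm (q powi e) \<le> 1"
  using norm_powi_le_power[OF q1 q0, of 0 e] by simp

lemma norm_x_powi_le:
  assumes "int c \<le> e" shows "norm (x powi e) \<le> norm x ^ c"
  using norm_powi_le_power[OF x1 x0] assms by simp

section \<open>Absolute convergence of the double series\<close>

definition lerch_dterm :: "int \<times> int \<Rightarrow> complex" where
  "lerch_dterm = (\<lambda>(n,k). of_int (hsgn n) * (- 1) powi n * q powi (tri (n + 1) + n * k) * x powi (n + 1 + k))"

definition lambert_dterm :: "int \<times> int \<Rightarrow> complex" where
  "lambert_dterm = (\<lambda>(m,k). of_int (hsgn m * m) * x powi m * q powi (m * k))"

definition const_dterm :: "int \<times> int \<Rightarrow> complex" where
  "const_dterm = (\<lambda>(m,k). - (of_int (hsgn m * m) * (- 1) powi m * q powi (tri (m + 1) + m * k)))"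

text \<open>For nonnegative pairs the powers of x decay. For negative pairs x has exponent - (a + b
  + 1), which is compensated by at least a + b + 1 factors of q, leaving powers of
  \<open>\<rho>\<close>.\<close>

lemma lerch_dterm_summable: "(\<lambda>p. norm (lerch_dterm p)) summable_on Sigma UNIV half"
proof (rule abs_summable_on_half[of "\<lambda>n. norm x ^ n" "\<lambda>n. norm x ^ n" "\<lambda>n. \<rho> ^ n" "\<lambda>n. \<rho> ^ n"])
  fix a b :: nat
  have "norm (q powi (tri (int a + 1) + int a * int b)) \<le> 1"
    using tri_int_ge(1)[of "Suc a"] by (intro norm_q_powi_le_1) (auto simp: add.commute)
  moreover have "norm (x powi (int a + 1 + int b)) \<le> norm x ^ (a + b)"
    by (rule norm_x_powi_le) simp
  ultimately have "norm (q powi (tri (int a + 1) + int a * int b)) * norm (x powi (int a + 1 + int b))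
      \<le> 1 * norm x ^ (a + b)"
    by (rule mult_mono) auto
  thus "norm (lerch_dterm (int a, int b)) \<le> norm x ^ a * norm x ^ b"
    by (simp add: lerch_dterm_def norm_mult norm_power_int norm_power hsgn_def power_add)
  have e: "int (a + b + 1) \<le> tri (- int a) + (1 + int a) * (1 + int b)"
  proof -
    have "0 \<le> int a * int b" by simp
    thus ?thesis using tri_int_ge(2)[of a] by (simp add: algebra_simps)
  qed
  have "norm (lerch_dterm (- 1 - int a, - 1 - int b)) =
        norm (q powi (tri (- int a) + (1 + int a) * (1 + int b))) / norm x ^ (a + b + 1)"
  proof -
    have 1: "(- 1 - int a) * (- 1 - int b) = (1 + int a) * (1 + int b)" by (simp add: algebra_simps)
    have 2: "- 1 - int a + 1 = - int a" by simp
    have 3: "- int a + (- 1 - int b) = - int (a + b + 1)" by simp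
    show ?thesis
      unfolding lerch_dterm_def prod.case 1 2 3 power_int_minus[of x] power_int_of_nat
      by (simp add: norm_mult norm_inverse norm_power norm_power_int hsgn_def divide_inverse)
  qed
  also have "\<dots> \<le> norm q ^ (a + b + 1) / norm x ^ (a + b + 1)"
    using norm_powi_le_power[OF q1 q0 e] by (rule divide_right_mono) simp
  also have "\<dots> = \<rho> ^ (a + b + 1)" by (simp add: power_divide)
  also have "\<dots> \<le> \<rho> ^ (a + b)" using rho by (intro power_decreasing) auto
  finally show "norm (lerch_dterm (- 1 - int a, - 1 - int b)) \<le> \<rho> ^ a * \<rho> ^ b"
    by (simp only: power_add)
qed (use summable_powers rho in auto)

lemma lambert_dterm_summable: "(\<lambda>p. norm (lambert_dterm p)) summable_on Sigma UNIV half"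
proof (rule abs_summable_on_half[of "\<lambda>n. real (Suc n) * norm x ^ n" "\<lambda>n. norm q ^ n"
         "\<lambda>n. real (Suc n) * \<rho> ^ n" "\<lambda>n. norm q ^ n"])
  fix a b :: nat
  show "norm (lambert_dterm (int a, int b)) \<le> real (Suc a) * norm x ^ a * norm q ^ b"
  \<comment> \<open>For a = 0 the factor m vanishes; without it there would be no decay in b.
    Otherwise b <= a * b supplies that decay.\<close>
  proof (cases "a = 0")
    case False
    hence "int b \<le> int a * int b" by (simp add: mult_le_cancel_right1)
    from norm_powi_le_power[OF q1 q0 this] show ?thesis
      by (simp add: lambert_dterm_def norm_mult hsgn_def norm_power mult_mono mult_nonneg_nonneg)
  qed (simp add: lambert_dterm_def)
  \<comment> \<open>Of these factors of q, a + 1 are matched with the negative power of x to form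
    powers of \<open>\<rho>\<close>, and b remain for the decay in b.\<close>
  have e: "int (Suc a + b) \<le> (1 + int a) * (1 + int b)"
  proof -
    have "0 \<le> int a * int b" by simp
    thus ?thesis by (simp add: algebra_simps)
  qed
  have "norm (lambert_dterm (- 1 - int a, - 1 - int b)) =
        real (Suc a) * (norm (q powi ((1 + int a) * (1 + int b))) / norm x ^ Suc a)"
  proof -
    have 1: "(- 1 - int a) * (- 1 - int b) = (1 + int a) * (1 + int b)" by (simp add: algebra_simps)
    have 2: "hsgn (- 1 - int a) * (- 1 - int a) = int (Suc a)" by (simp add: hsgn_def)
    have 3: "x powi (- 1 - int a) = inverse (x ^ Suc a)"
    proof -
      have "- 1 - int a = - int (Suc a)" by simp
      thus ?thesis by (simp only: power_int_minus power_int_of_nat)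
    qed
    show ?thesis
      unfolding lambert_dterm_def prod.case 1 2 3
      by (simp add: norm_mult norm_inverse norm_power divide_inverse del: of_nat_Suc)
  qed
  also have "\<dots> \<le> real (Suc a) * (norm q ^ (Suc a + b) / norm x ^ Suc a)"
    using norm_powi_le_power[OF q1 q0 e] by (intro mult_left_mono divide_right_mono) auto
  also have "\<dots> = real (Suc a) * (\<rho> ^ Suc a * norm q ^ b)" by (simp add: power_divide power_add)
  also have "\<dots> \<le> real (Suc a) * (\<rho> ^ a * norm q ^ b)" using rho
    by (intro mult_left_mono mult_right_mono power_decreasing) auto
  finally show "norm (lambert_dterm (- 1 - int a, - 1 - int b)) \<le> real (Suc a) * \<rho> ^ a * norm q ^ b"
    by (simp only: mult.assoc)
qed (use summable_powers rho in \<open>auto simp del: of_nat_Suc\<close>)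

lemma const_dterm_summable: "(\<lambda>p. norm (const_dterm p)) summable_on Sigma UNIV half"
proof (rule abs_summable_on_half[of "\<lambda>n. real (Suc n) * norm q ^ n" "\<lambda>n. norm q ^ n"
         "\<lambda>n. real (Suc n) * norm q ^ n" "\<lambda>n. norm q ^ n"])
  fix a b :: nat
  show "norm (const_dterm (int a, int b)) \<le> real (Suc a) * norm q ^ a * norm q ^ b"
  proof (cases "a = 0")
    case False
    hence "int b \<le> int a * int b" by (simp add: mult_le_cancel_right1)
    hence "int (a + b) \<le> tri (int a + 1) + int a * int b"
      using tri_int_ge(1)[of a] by (simp add: tri_add_1)
    from norm_powi_le_power[OF q1 q0 this] show ?thesis
      by (simp add: const_dterm_def norm_mult hsgn_def norm_power norm_power_int power_add
           mult.assoc mult_mono)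
  qed (simp add: const_dterm_def)
  have e: "int (a + b) \<le> tri (- int a) + (1 + int a) * (1 + int b)"
  proof -
    have "0 \<le> int a * int b" by simp
    thus ?thesis using tri_int_ge(2)[of a] by (simp add: algebra_simps)
  qed
  have "norm (const_dterm (- 1 - int a, - 1 - int b)) =
        real (Suc a) * norm (q powi (tri (- int a) + (1 + int a) * (1 + int b)))"
  proof -
    have 1: "(- 1 - int a) * (- 1 - int b) = (1 + int a) * (1 + int b)" by (simp add: algebra_simps)
    have 2: "- 1 - int a + 1 = - int a" by simp
    have 3: "hsgn (- 1 - int a) * (- 1 - int a) = int (Suc a)" by (simp add: hsgn_def)
    show ?thesis
      unfolding const_dterm_def prod.case 1 2 3 by (simp add: norm_mult norm_power_int del: of_nat_Suc)
  qed
  also have "\<dots> \<le> real (Suc a) * norm q ^ (a + b)"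
    using norm_powi_le_power[OF q1 q0 e] by (intro mult_left_mono) auto
  finally show "norm (const_dterm (- 1 - int a, - 1 - int b)) \<le> real (Suc a) * norm q ^ a * norm q ^ b"
    by (simp only: mult.assoc power_add)
qed (use summable_powers rho in \<open>auto simp del: of_nat_Suc\<close>)

lemma norm_powi_inverse: "norm (q powi m) = inverse (norm (q powi - m))"
  by (simp add: power_int_minus norm_inverse)

lemma norm_q_powi: "0 < m \<Longrightarrow> norm (q powi m) < 1" "m < 0 \<Longrightarrow> norm (q powi m) > 1"
proof -
  show *: "norm (q powi m) < 1" if "0 < m" for m
    using norm_powi_le_power[OF q1 q0, of 1 m] that q1 by simp
  show "norm (q powi m) > 1" if "m < 0"
    unfolding norm_powi_inverse[of m] using *[of "- m"] that q0 by (intro one_less_inverse) auto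
qed

lemma norm_x_q_powi: "0 \<le> m \<Longrightarrow> norm (x * q powi m) < 1" "m < 0 \<Longrightarrow> norm (x * q powi m) > 1"
proof -
  assume "0 \<le> m"
  hence "norm (q powi m) \<le> 1" by (rule norm_q_powi_le_1)
  hence "norm x * norm (q powi m) \<le> norm x" by (intro mult_left_le) auto
  thus "norm (x * q powi m) < 1" using x1 by (simp only: norm_mult)
next
  assume "m < 0"
  hence "norm (q powi (- m)) \<le> norm q"
    using norm_powi_le_power[OF q1 q0, of 1 "- m"] by simp
  hence "norm (q powi (- m)) < norm x" using qx by simp
  thus "norm (x * q powi m) > 1"
    unfolding norm_mult norm_powi_inverse[of m] using q0 by (simp add: field_simps del: norm_power_int)
qed

lemma lerch_inner: "((\<lambda>k. lerch_dterm (n, k)) has_sum lerch_term x q n) (half n)"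
proof -
  have "((\<lambda>k. (- 1) powi n * q powi tri (n + 1) * x powi (n + 1) * (of_int (hsgn n) * (x * q powi n) powi k))
           has_sum (- 1) powi n * q powi tri (n + 1) * x powi (n + 1) * (1 / (1 - x * q powi n))) (half n)"
    by (intro has_sum_cmult_right has_sum_half_geometric norm_x_q_powi)
  also have "(\<lambda>k. (- 1) powi n * q powi tri (n + 1) * x powi (n + 1) * (of_int (hsgn n) * (x * q powi n) powi k))
      = (\<lambda>k. lerch_dterm (n, k))"
  proof
    fix k
    have "q powi (tri (n + 1) + n * k) = q powi tri (n + 1) * (q powi n) powi k"
         "x powi (n + 1 + k) = x powi (n + 1) * x powi k"
         "(x * q powi n) powi k = x powi k * (q powi n) powi k"
      by (rule power_int_add[OF disjI1[OF q0], of "tri (n + 1)" "n * k", unfolded power_int_mult]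
          power_int_add[OF disjI1[OF x0]] power_int_mult_distrib)+
    note eqs = this
    show "(- 1) powi n * q powi tri (n + 1) * x powi (n + 1) * (of_int (hsgn n) * (x * q powi n) powi k)
      = lerch_dterm (n, k)"
      unfolding lerch_dterm_def prod.case eqs by (simp only: mult_ac)
  qed
  finally show ?thesis by (simp add: lerch_term_def)
qed

lemma lambert_inner: "((\<lambda>k. lambert_dterm (m, k)) has_sum lambert_term x q m) (half m)"
proof (cases "m = 0")
  case False
  have "((\<lambda>k. of_int m * x powi m * (of_int (hsgn m) * (q powi m) powi k))
           has_sum of_int m * x powi m * (1 / (1 - q powi m))) (half m)"
    using False by (intro has_sum_cmult_right has_sum_half_geometric norm_q_powi) auto
  also have "(\<lambda>k. of_int m * x powi m * (of_int (hsgn m) * (q powi m) powi k)) = (\<lambda>k. lambert_dterm (m, k))"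
    unfolding lambert_dterm_def prod.case power_int_mult of_int_mult by (simp only: mult_ac)
  finally show ?thesis by (simp add: lambert_term_def)
qed (simp add: lambert_dterm_def lambert_term_def)

lemma const_inner: "((\<lambda>k. const_dterm (m, k)) has_sum const_term q m) (half m)"
proof (cases "m = 0")
  case False
  have "((\<lambda>k. - (of_int m * (- 1) powi m * q powi tri (m + 1)) * (of_int (hsgn m) * (q powi m) powi k))
           has_sum - (of_int m * (- 1) powi m * q powi tri (m + 1)) * (1 / (1 - q powi m))) (half m)"
    using False by (intro has_sum_cmult_right has_sum_half_geometric norm_q_powi) auto
  also have "(\<lambda>k. - (of_int m * (- 1) powi m * q powi tri (m + 1)) * (of_int (hsgn m) * (q powi m) powi k))
        = (\<lambda>k. const_dterm (m, k))"
  proof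
    fix k
    have "q powi (tri (m + 1) + m * k) = q powi tri (m + 1) * (q powi m) powi k"
      by (rule power_int_add[OF disjI1[OF q0], of "tri (m + 1)" "m * k", unfolded power_int_mult])
    note eqs = this
    show "- (of_int m * (- 1) powi m * q powi tri (m + 1)) * (of_int (hsgn m) * (q powi m) powi k)
        = const_dterm (m, k)"
      unfolding const_dterm_def prod.case eqs of_int_mult by (simp only: mult_ac mult_minus_left mult_minus_right)
  qed
  finally show ?thesis by (simp add: const_term_def)
qed (simp add: const_dterm_def const_term_def)

lemma half_sums:
  assumes "(\<lambda>p. norm (f p :: complex)) summable_on Sigma UNIV half"
    and "\<And>n. ((\<lambda>k. f (n, k)) has_sum g n) (half n)"
  shows "(f has_sum (\<Sum>\<^sub>\<infinity>n. g n)) (Sigma UNIV half)" "(g has_sum (\<Sum>\<^sub>\<infinity>n. g n)) UNIV"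
proof -
  have f: "(f has_sum infsum f (Sigma UNIV half)) (Sigma UNIV half)"
    by (rule has_sum_infsum[OF abs_summable_summable[OF assms(1)]])
  have g: "(g has_sum infsum f (Sigma UNIV half)) UNIV"
    by (rule has_sum_SigmaD[OF f]) (rule assms(2))
  have eq: "(\<Sum>\<^sub>\<infinity>n. g n) = infsum f (Sigma UNIV half)"
    by (rule infsumI) (rule g)
  show "(f has_sum (\<Sum>\<^sub>\<infinity>n. g n)) (Sigma UNIV half)" unfolding eq by (rule f)
  show "(g has_sum (\<Sum>\<^sub>\<infinity>n. g n)) UNIV" unfolding eq by (rule g)
qed

lemmas lerch_sums = half_sums[OF lerch_dterm_summable lerch_inner]
lemmas lambert_sums = half_sums[OF lambert_dterm_summable lambert_inner]
lemmas const_sums = half_sums[OF const_dterm_summable const_inner]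

lemma theta_has_sum: "(theta_term x q has_sum (\<Sum>\<^sub>\<infinity>n. theta_term x q n)) UNIV"
  using jacobi_triple_product[OF q0 qx x1] by (metis infsumI)

text \<open>A shared criterion for \<open>cube_term\<close> and the alternating series below:
  \<open>tri (k + 1)\<close> is at least n for k = n and for k = - 1 - n.\<close>

lemma cube_like_has_sum:
  fixes f :: "int \<Rightarrow> complex"
  assumes f: "\<And>k. norm (f k) \<le> (1 + \<bar>of_int k\<bar>) * norm (q powi tri (k + 1))"
  shows "(f has_sum (\<Sum>\<^sub>\<infinity>k. f k)) UNIV"
proof (rule has_sum_infsum, rule abs_summable_summable, rule abs_summable_on_int)
  have "norm (f (int n)) \<le> real (Suc n) * norm q ^ n" for n
  proof -
    have "int n \<le> tri (int n + 1)" using tri_int_ge(1)[of n] by (simp add: tri_add_1)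
    hence "(1 + \<bar>of_int (int n)\<bar>) * norm (q powi tri (int n + 1)) \<le> real (Suc n) * norm q ^ n"
      using norm_powi_le_power[OF q1 q0] by (intro mult_mono) auto
    with f[of "int n"] show ?thesis by (rule order_trans)
  qed
  thus "summable (\<lambda>n. norm (f (int n)))"
    by (intro summable_comparison_test'[OF summable_powers(5), of 0]) simp
  have "norm (f (- 1 - int n)) \<le> 2 * (real (Suc n) * norm q ^ n)" for n
  proof -
    have "norm (f (- 1 - int n)) \<le> (2 + real n) * norm (q powi tri (- int n))"
      using f[of "- 1 - int n"] by (simp add: add.commute)
    also have "\<dots> \<le> (2 * real (Suc n)) * norm q ^ n"
      using norm_powi_le_power[OF q1 q0 tri_int_ge(2)[of n]] by (intro mult_mono) auto
    finally show ?thesis by (simp only: mult.assoc)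
  qed
  thus "summable (\<lambda>n. norm (f (- 1 - int n)))"
    by (intro summable_comparison_test'[OF summable_mult[OF summable_powers(5), of 2], of 0]) simp
qed

lemma cube_has_sum: "(cube_term q has_sum (\<Sum>\<^sub>\<infinity>k. cube_term q k)) UNIV"
  by (rule cube_like_has_sum) (auto simp: cube_term_def norm_mult norm_power_int intro!: mult_right_mono)

text \<open>The involution k -> - 1 - k fixes \<open>tri (k + 1)\<close> and reverses the sign, so
  the sum equals its own negative.\<close>

lemma alternating_has_sum: "((\<lambda>k. (- 1) powi k * q powi tri (k + 1)) has_sum 0) UNIV"
proof -
  let ?f = "\<lambda>k. (- 1) powi k * q powi tri (k + 1)"
  define s where "s = (\<Sum>\<^sub>\<infinity>k. ?f k)"
  have s: "(?f has_sum s) UNIV"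
    unfolding s_def by (rule cube_like_has_sum) (auto simp: norm_mult norm_power_int distrib_right)
  have t: "tri (- k) = tri (k + 1)" for k
  proof -
    have "2 * tri (- k) = 2 * tri (k + 1)" unfolding two_tri by (simp add: algebra_simps)
    thus ?thesis by simp
  qed
  have "((\<lambda>k. - ?f k) has_sum - s) UNIV" using s by (rule has_sum_uminusI)
  also have "?this \<longleftrightarrow> (?f has_sum - s) UNIV"
  proof (rule has_sum_reindex_bij_witness[of _ "\<lambda>k. - 1 - k" "\<lambda>k. - 1 - k"])
    fix k :: int
    have "(- 1) powi (- 1 - k) = - ((- 1) powi k :: complex)"
      by (simp add: power_int_diff power_int_minus_left)
    thus "?f (- 1 - k) = - ?f k" by (simp add: t)
  qed auto
  finally have "s = - s" using s has_sum_unique by blast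
  with s show ?thesis by simp
qed

section \<open>Laurent coefficients in x and their recurrences\<close>

definition lerch_coeff_term :: "int \<Rightarrow> int \<Rightarrow> complex" where
  "lerch_coeff_term N n = (if N - 1 - n \<in> half n
     then of_int (hsgn n) * (- 1) powi n * q powi (tri (n + 1) + n * (N - 1 - n)) else 0)"

definition lerch_coeff :: "int \<Rightarrow> complex" where
  "lerch_coeff N = (\<Sum>\<^sub>\<infinity>n. lerch_coeff_term N n)"

lemma lerch_coeff_sums:
  "(lerch_coeff_term N has_sum lerch_coeff N) UNIV"
  "((\<lambda>N. lerch_coeff N * x powi N) has_sum (\<Sum>\<^sub>\<infinity>n. lerch_term x q n)) UNIV"
proof -
  let ?S = "\<Sum>\<^sub>\<infinity>n. lerch_term x q n" and ?g = "\<lambda>(N,n). lerch_coeff_term N n * x powi N"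
  let ?A = "Sigma UNIV (\<lambda>N. {n. N - 1 - n \<in> half n})"
  have "(lerch_dterm has_sum ?S) (Sigma UNIV half) \<longleftrightarrow> (?g has_sum ?S) ?A"
    by (rule has_sum_reindex_bij_witness[of _ "\<lambda>(N,n). (n, N - 1 - n)" "\<lambda>(n,k). (n + 1 + k, n)"])
       (auto simp: lerch_dterm_def lerch_coeff_term_def)
  also have "(?g has_sum ?S) ?A \<longleftrightarrow> (?g has_sum ?S) (UNIV \<times> UNIV)"
    by (rule has_sum_cong_neutral) (auto simp: lerch_coeff_term_def split: if_splits)
  finally have g: "(?g has_sum ?S) (UNIV \<times> UNIV)" using lerch_sums(1) by simp
  have *: "(lerch_coeff_term N has_sum lerch_coeff N) UNIV" for N
  proof -
    have "(\<lambda>n. lerch_coeff_term N n * x powi N) summable_on UNIV"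
      using summable_on_SigmaD1[OF has_sum_imp_summable[OF g], of N] by simp
    hence "lerch_coeff_term N summable_on UNIV"
      using x0 by (subst (asm) summable_on_cmult_left') auto
    thus ?thesis unfolding lerch_coeff_def by (rule has_sum_infsum)
  qed
  show "(lerch_coeff_term N has_sum lerch_coeff N) UNIV" by (rule *)
  show "((\<lambda>N. lerch_coeff N * x powi N) has_sum ?S) UNIV"
    by (rule has_sum_SigmaD[OF g]) (auto intro!: has_sum_cmult_left *)
qed

text \<open>For N = 0 the inner index would be k = - 1 - n, which never lies in
  \<open>half n\<close>.\<close>

lemma lerch_coeff_0: "lerch_coeff 0 = 0"
proof -
  have "lerch_coeff_term 0 = (\<lambda>_. 0)"
    by (auto simp: lerch_coeff_term_def half_def fun_eq_iff)
  thus ?thesis by (simp add: lerch_coeff_def)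
qed

text \<open>After the shift both terms carry the same inner index N - n, the same power of q and
  opposite signs, so they cancel unless n = 0. There \<open>half 0\<close> and
  \<open>half (- 1)\<close> are complementary, and exactly one of the two terms is present, with
  value 1.\<close>

lemma lerch_coeff_rec: "lerch_coeff (N + 1) + q powi N * lerch_coeff N = 1"
proof -
  have "((\<lambda>n. lerch_coeff_term N (n - 1)) has_sum lerch_coeff N) UNIV"
    using has_sum_int_shift[of "lerch_coeff_term N" "-1"] lerch_coeff_sums(1)[of N] by simp
  hence "((\<lambda>n. lerch_coeff_term (N + 1) n + q powi N * lerch_coeff_term N (n - 1))
          has_sum (lerch_coeff (N + 1) + q powi N * lerch_coeff N)) UNIV"
    by (intro has_sum_add has_sum_cmult_right lerch_coeff_sums)
  also have "(\<lambda>n. lerch_coeff_term (N + 1) n + q powi N * lerch_coeff_term N (n - 1)) =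
             (\<lambda>n. if n = 0 then 1 else 0)"
  proof
    fix n
    have e: "tri (n - 1 + 1) + (n - 1) * (N - 1 - (n - 1)) + N = tri (n + 1) + n * (N + 1 - 1 - n)"
      using tri_add_1[of n] by (simp add: algebra_simps)
    have s: "(- 1) powi (n - 1) = - ((- 1) powi n :: complex)"
      by (simp add: power_int_diff)
    have "q powi N * lerch_coeff_term N (n - 1) = (if N - n \<in> half (n - 1)
       then - (of_int (hsgn (n - 1)) * (- 1) powi n * q powi (tri (n + 1) + n * (N + 1 - 1 - n))) else 0)"
      unfolding lerch_coeff_term_def e[symmetric] s power_int_add[OF disjI1[OF q0]] by simp
    thus "lerch_coeff_term (N + 1) n + q powi N * lerch_coeff_term N (n - 1) = (if n = 0 then 1 else 0)"
      by (auto simp: lerch_coeff_term_def half_def hsgn_def tri_def)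
  qed
  finally show ?thesis
    using has_sum_unique has_sum_finite_neutralI[of "{0::int}" UNIV "\<lambda>n. if n = 0 then 1 else 0 :: complex" 1]
    by auto
qed

text \<open>The contribution to x^N of the product of the Lambert series and the theta series that
  takes x^m from the former.\<close>

definition lambert_coeff_term :: "int \<Rightarrow> int \<Rightarrow> complex" where
  "lambert_coeff_term N m = of_int m / (1 - q powi m) * ((- 1) powi (N - m) * q powi tri (N - m))"

definition lambert_coeff :: "int \<Rightarrow> complex" where
  "lambert_coeff N = (\<Sum>\<^sub>\<infinity>m. lambert_coeff_term N m)"

lemma lambert_coeff_sums:
  "(lambert_coeff_term N has_sum lambert_coeff N) UNIV"
  "((\<lambda>N. lambert_coeff N * x powi N) has_sum
      (\<Sum>\<^sub>\<infinity>m. lambert_term x q m) * (\<Sum>\<^sub>\<infinity>n. theta_term x q n)) UNIV"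
proof -
  let ?S = "(\<Sum>\<^sub>\<infinity>m. lambert_term x q m) * (\<Sum>\<^sub>\<infinity>n. theta_term x q n)"
  let ?g = "\<lambda>(N,m). lambert_coeff_term N m * x powi N"
  have "((\<lambda>(m,n). lambert_term x q m * theta_term x q n) has_sum ?S) (UNIV \<times> UNIV)"
    by (rule has_sum_product[OF lambert_sums(2) theta_has_sum])
  also have "?this \<longleftrightarrow> (?g has_sum ?S) (UNIV \<times> UNIV)"
    using x0
    by (intro has_sum_reindex_bij_witness[of _ "\<lambda>(N,m). (m, N - m)" "\<lambda>(m,n). (m + n, m)"])
       (auto simp: lambert_term_def theta_term_def lambert_coeff_term_def power_int_add)
  finally have g: "(?g has_sum ?S) (UNIV \<times> UNIV)" .
  have *: "(lambert_coeff_term N has_sum lambert_coeff N) UNIV" for N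
  proof -
    have "(\<lambda>n. lambert_coeff_term N n * x powi N) summable_on UNIV"
      using summable_on_SigmaD1[OF has_sum_imp_summable[OF g], of N] by simp
    hence "lambert_coeff_term N summable_on UNIV"
      using x0 by (subst (asm) summable_on_cmult_left') auto
    thus ?thesis unfolding lambert_coeff_def by (rule has_sum_infsum)
  qed
  show "(lambert_coeff_term N has_sum lambert_coeff N) UNIV" by (rule *)
  show "((\<lambda>N. lambert_coeff N * x powi N) has_sum ?S) UNIV"
    by (rule has_sum_SigmaD[OF g]) (auto intro!: has_sum_cmult_left *)
qed

lemma lambert_coeff_0: "lambert_coeff 0 = - (\<Sum>\<^sub>\<infinity>m. const_term q m)"
proof -
  have "lambert_coeff_term 0 m = - const_term q m" for m
  proof -
    have "2 * tri (- m) = 2 * tri (m + 1)" unfolding two_tri by (simp add: algebra_simps)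
    hence "tri (- m) = tri (m + 1)" by simp
    thus ?thesis
      by (simp add: lambert_coeff_term_def const_term_def power_int_minus power_int_minus_left)
  qed
  hence eq: "lambert_coeff_term 0 = (\<lambda>m. - const_term q m)" by (rule ext)
  have "(lambert_coeff_term 0 has_sum - (\<Sum>\<^sub>\<infinity>m. const_term q m)) UNIV"
    unfolding eq by (rule has_sum_uminusI[OF const_sums(2)])
  thus ?thesis using lambert_coeff_sums(1)[of 0] has_sum_unique by blast
qed

text \<open>Put k = N - m. The two terms combine to a multiple of q^N - q^k = - (1 - q^m) q^k, which
  cancels the denominator and leaves the factor - m = k - N. The part with k is the cube series, and
  the part with N vanishes by \<open>alternating_has_sum\<close>.\<close>

lemma lambert_coeff_rec:
  "lambert_coeff (N + 1) + q powi N * lambert_coeff N = (\<Sum>\<^sub>\<infinity>k. cube_term q k)"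
proof -
  have 1: "((\<lambda>m. lambert_coeff_term (N + 1) m + q powi N * lambert_coeff_term N m)
          has_sum (lambert_coeff (N + 1) + q powi N * lambert_coeff N)) UNIV"
    by (intro has_sum_add has_sum_cmult_right lambert_coeff_sums)
  have "((\<lambda>k. cube_term q k + - (of_int N * ((- 1) powi k * q powi tri (k + 1))))
          has_sum ((\<Sum>\<^sub>\<infinity>k. cube_term q k) + - (of_int N * 0))) UNIV"
    by (intro has_sum_add has_sum_uminusI has_sum_cmult_right cube_has_sum alternating_has_sum)
  also have "?this \<longleftrightarrow> ((\<lambda>m. lambert_coeff_term (N + 1) m + q powi N * lambert_coeff_term N m)
          has_sum (\<Sum>\<^sub>\<infinity>k. cube_term q k)) UNIV"
  proof (rule has_sum_reindex_bij_witness[of _ "\<lambda>m. N - m" "\<lambda>k. N - k"])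
    fix k :: int
    define m where "m = N - k"
    have k: "k = N - m" by (simp add: m_def)
    have "N + 1 - m = k + 1" by (simp add: k)
    hence t: "tri (N + 1 - m) = tri k + k" by (simp only: tri_add_1)
    have s: "(- 1) powi (N + 1 - m) = - ((- 1) powi k :: complex)"
      by (simp add: k power_int_add power_int_diff)
    have N: "N = m + k" by (simp add: k)
    show "lambert_coeff_term (N + 1) (N - k) + q powi N * lambert_coeff_term N (N - k) =
          cube_term q k + - (of_int N * ((- 1) powi k * q powi tri (k + 1)))"
    \<comment> \<open>For m = 0 there is nothing to cancel: the left side is 0 and k = N makes the
      right side 0.\<close>
    proof (cases "m = 0")
      case False
      hence "1 - q powi m \<noteq> 0"
        using norm_q_powi[of m] by (cases "m > 0") (auto simp del: norm_power_int)
      have "lambert_coeff_term (N + 1) m + q powi N * lambert_coeff_term N m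
          = of_int m / (1 - q powi m) * ((- 1) powi k * q powi tri k * (q powi N - q powi k))"
        unfolding lambert_coeff_term_def t s k[symmetric] using q0
        by (simp add: power_int_add algebra_simps)
      also have "q powi N - q powi k = - (1 - q powi m) * q powi k"
        unfolding N using q0 by (simp add: power_int_add algebra_simps)
      also have "of_int m / (1 - q powi m) * ((- 1) powi k * q powi tri k * (- (1 - q powi m) * q powi k))
          = - of_int m * ((- 1) powi k * q powi tri (k + 1))"
      proof -
        have "M / u * (s * t * (- u * w)) = - M * (s * (t * w))" if "u \<noteq> 0" for M u s t w :: complex
          using that by simp
        moreover have "q powi tri (k + 1) = q powi tri k * q powi k"
          unfolding tri_add_1 by (rule power_int_add[OF disjI1[OF q0]])
        ultimately show ?thesis using \<open>1 - q powi m \<noteq> 0\<close> by (simp only: not_False_eq_True)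
      qed
      finally show ?thesis
        unfolding m_def[symmetric] by (simp add: cube_term_def N algebra_simps)
    qed (simp add: m_def lambert_coeff_term_def cube_term_def)
  qed auto
  finally show ?thesis using 1 has_sum_unique by blast
qed

text \<open>In \<open>d\<close> the inhomogeneous parts of the two recurrences cancel. The theta
  coefficients obey the same homogeneous recurrence, so \<open>d\<close> is their multiple by its
  value at 0, and summing against the powers of x gives the identity.\<close>

theorem lerch_lambert_identity:
  "(\<Sum>\<^sub>\<infinity>k. cube_term q k) * (\<Sum>\<^sub>\<infinity>n. lerch_term x q n) =
   ((\<Sum>\<^sub>\<infinity>m. const_term q m) + (\<Sum>\<^sub>\<infinity>m. lambert_term x q m)) * (\<Sum>\<^sub>\<infinity>n. theta_term x q n)"
proof -
  let ?D = "\<Sum>\<^sub>\<infinity>k. cube_term q k" and ?C = "\<Sum>\<^sub>\<infinity>m. const_term q m"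
  define d where "d N = ?D * lerch_coeff N - lambert_coeff N" for N
  have rec: "d (N + 1) = - (q powi N) * d N" for N
  proof -
    have *: "lerch_coeff (N + 1) = 1 - q powi N * lerch_coeff N"
         "lambert_coeff (N + 1) = ?D - q powi N * lambert_coeff N"
      using lerch_coeff_rec[of N] lambert_coeff_rec[of N] by (auto simp: eq_diff_eq)
    show ?thesis unfolding d_def * by (simp add: algebra_simps)
  qed
  have d: "d N = ?C * ((- 1) powi N * q powi tri N)" for N
  proof (induction N rule: int_induct[where k = 0])
    case base
    show ?case by (simp add: d_def lerch_coeff_0 lambert_coeff_0 tri_def)
  next
    case (step1 i)
    thus ?case using q0 by (simp add: rec tri_add_1 power_int_add)
  next
    case (step2 i)
    \<comment> \<open>Downwards the recurrence is solved for the earlier value, which is possible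
      because q is nonzero.\<close>
    have "- (q powi (i - 1)) * d (i - 1) = d i" using rec[of "i - 1"] by simp
    also have "\<dots> = - (q powi (i - 1)) * (?C * ((- 1) powi (i - 1) * q powi tri (i - 1)))"
      using step2 q0 tri_add_1[of "i - 1"] by (simp add: power_int_add power_int_diff)
    finally show ?case using q0 by simp
  qed
  have "((\<lambda>N. ?D * (lerch_coeff N * x powi N) + - (lambert_coeff N * x powi N)) has_sum
     ?D * (\<Sum>\<^sub>\<infinity>n. lerch_term x q n) +
     - ((\<Sum>\<^sub>\<infinity>m. lambert_term x q m) * (\<Sum>\<^sub>\<infinity>n. theta_term x q n))) UNIV"
    by (intro has_sum_add has_sum_uminusI has_sum_cmult_right lerch_coeff_sums lambert_coeff_sums)
  also have "(\<lambda>N. ?D * (lerch_coeff N * x powi N) + - (lambert_coeff N * x powi N)) =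
             (\<lambda>N. ?C * theta_term x q N)"
  proof
    fix N
    have "?D * (lerch_coeff N * x powi N) + - (lambert_coeff N * x powi N) = d N * x powi N"
      by (simp add: d_def algebra_simps)
    thus "?D * (lerch_coeff N * x powi N) + - (lambert_coeff N * x powi N) = ?C * theta_term x q N"
      by (simp add: d theta_term_def)
  qed
  finally have "?D * (\<Sum>\<^sub>\<infinity>n. lerch_term x q n) +
     - ((\<Sum>\<^sub>\<infinity>m. lambert_term x q m) * (\<Sum>\<^sub>\<infinity>n. theta_term x q n)) =
     ?C * (\<Sum>\<^sub>\<infinity>n. theta_term x q n)"
    using has_sum_cmult_right[OF theta_has_sum] has_sum_unique by blast
  thus ?thesis by (simp add: algebra_simps add_eq_0_iff)
qed

end

section \<open>The coefficients of the generating function\<close>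

text \<open>An integer-valued form of the sign (-1)^n, as \<open>family_fps\<close> takes integer
  weights.\<close>

definition alt_sgn :: "int \<Rightarrow> int" where
  "alt_sgn n = (if even n then 1 else - 1)"

lemma of_int_alt_sgn: "of_int (alt_sgn n) = ((- 1) powi n :: complex)"
  by (simp add: alt_sgn_def power_int_minus_left)

lemma tri_bounds: "0 \<le> tri m" "- m \<le> tri m"
proof -
  have "0 \<le> tri m \<and> - m \<le> tri m"
    using tri_int_ge(1)[of "nat m"] tri_int_ge(2)[of "nat (- m)"] by (cases "0 \<le> m") auto
  thus "0 \<le> tri m" "- m \<le> tri m" by auto
qed

text \<open>These inequalities serve to show that the exponents of the families below are
  nonnegative, so that \<open>nat\<close> truncates nothing.\<close>

lemma half_mult_bounds:
  assumes "k \<in> half n"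
  shows "0 \<le> n * k" "0 \<le> (n + 1) * (k + 1)" "0 \<le> n * (k + 1) \<or> 0 \<le> n"
  using assms by (auto simp: half_def zero_le_mult_iff)

lemma powi_eq_power_nat: "0 \<le> e \<Longrightarrow> (q::complex) powi e = q ^ nat e"
  by (simp add: power_int_def)

lemma power_powi: "(q ^ c :: complex) powi m = q powi (int c * m)"
  by (rule power_int_power)

lemma theta_domain_powers:
  assumes "0 < norm (q::complex)" "norm q < 1"
  shows "theta_domain (q ^ 3) (q ^ 10)"
proof
  show "norm (q ^ 10) < norm (q ^ 3)"
    using assms power_strict_decreasing[of 3 10 "norm q"] by (simp add: norm_power)
  show "norm (q ^ 3) < 1"
    using assms by (simp add: norm_power power_less_one_iff)
qed (use assms in auto)

section \<open>The five series as integer power series in q, with x = q^3 and base q^10\<close>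

definition "theta_fps = family_fps UNIV alt_sgn (\<lambda>n. nat (10 * tri n + 3 * n))"

definition "cube_fps = family_fps UNIV (\<lambda>k. k * alt_sgn k) (\<lambda>k. nat (10 * tri (k + 1)))"

definition "lerch_fps = family_fps (Sigma UNIV half) (\<lambda>(n,k). hsgn n * alt_sgn n)
   (\<lambda>(n,k). nat (10 * (tri (n + 1) + n * k) + 3 * (n + 1 + k)))"

definition "lambert_fps = family_fps (Sigma UNIV half) (\<lambda>(m,k). hsgn m * m)
   (\<lambda>(m,k). nat (3 * m + 10 * (m * k)))"

definition "const_fps = family_fps (Sigma UNIV half) (\<lambda>(m,k). - (hsgn m * m * alt_sgn m))
   (\<lambda>(m,k). nat (10 * (tri (m + 1) + m * k)))"

lemma theta_exponent_nonneg: "0 \<le> 10 * tri n + 3 * n"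
  using tri_bounds[of n] by linarith

lemma theta_series:
  "int_series theta_fps (\<lambda>q. \<Sum>\<^sub>\<infinity>n. theta_term (q ^ 3) (q ^ 10) n)"
  unfolding theta_fps_def
proof (rule int_series_family)
  fix q :: complex assume q: "0 < norm q" "norm q < 1"
  interpret theta_domain "q ^ 3" "q ^ 10" by (rule theta_domain_powers[OF q])
  have q0: "q \<noteq> 0" using q by auto
  have "theta_term (q ^ 3) (q ^ 10) = (\<lambda>n. of_int (alt_sgn n) * q ^ nat (10 * tri n + 3 * n))"
  proof
    fix n
    show "theta_term (q ^ 3) (q ^ 10) n = of_int (alt_sgn n) * q ^ nat (10 * tri n + 3 * n)"
      unfolding powi_eq_power_nat[OF theta_exponent_nonneg, symmetric] power_int_add[OF disjI1[OF q0]]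
        theta_term_def of_int_alt_sgn power_powi by simp
  qed
  thus "((\<lambda>n. of_int (alt_sgn n) * q ^ nat (10 * tri n + 3 * n)) has_sum
          (\<Sum>\<^sub>\<infinity>n. theta_term (q ^ 3) (q ^ 10) n)) UNIV"
    using theta_has_sum by simp
qed

lemma cube_series:
  "int_series cube_fps (\<lambda>q. \<Sum>\<^sub>\<infinity>k. cube_term (q ^ 10) k)"
  unfolding cube_fps_def
proof (rule int_series_family)
  fix q :: complex assume q: "0 < norm q" "norm q < 1"
  interpret theta_domain "q ^ 3" "q ^ 10" by (rule theta_domain_powers[OF q])
  have "cube_term (q ^ 10) = (\<lambda>k. of_int (k * alt_sgn k) * q ^ nat (10 * tri (k + 1)))"
  proof
    fix k
    have e: "0 \<le> 10 * tri (k + 1)" using tri_bounds(1) by simp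
    show "cube_term (q ^ 10) k = of_int (k * alt_sgn k) * q ^ nat (10 * tri (k + 1))"
      unfolding powi_eq_power_nat[OF e, symmetric] cube_term_def of_int_mult of_int_alt_sgn power_powi
      by simp
  qed
  thus "((\<lambda>k. of_int (k * alt_sgn k) * q ^ nat (10 * tri (k + 1))) has_sum
          (\<Sum>\<^sub>\<infinity>k. cube_term (q ^ 10) k)) UNIV"
    using cube_has_sum by simp
qed

lemma lerch_series:
  "int_series lerch_fps (\<lambda>q. \<Sum>\<^sub>\<infinity>n. lerch_term (q ^ 3) (q ^ 10) n)"
  unfolding lerch_fps_def
proof (rule int_series_family)
  fix q :: complex assume q: "0 < norm q" "norm q < 1"
  interpret theta_domain "q ^ 3" "q ^ 10" by (rule theta_domain_powers[OF q])
  have q0: "q \<noteq> 0" using q by auto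
  let ?t = "\<lambda>p. of_int ((\<lambda>(n,k). hsgn n * alt_sgn n) p) *
     q ^ (\<lambda>(n,k). nat (10 * (tri (n + 1) + n * k) + 3 * (n + 1 + k))) p"
  have "lerch_dterm p = ?t p" if mem: "p \<in> Sigma UNIV half" for p
  proof -
    obtain n k where p: "p = (n, k)" and k: "k \<in> half n" using mem by auto
    \<comment> \<open>The exponent equals 10 tri (n + 1) + 7 n k + 3 (n + 1) (k + 1).\<close>
    have e: "0 \<le> 10 * (tri (n + 1) + n * k) + 3 * (n + 1 + k)"
      using half_mult_bounds[OF k] tri_bounds(1)[of "n + 1"] by (simp add: algebra_simps)
    show ?thesis
      unfolding p prod.case powi_eq_power_nat[OF e, symmetric] power_int_add[OF disjI1[OF q0]]
        lerch_dterm_def of_int_mult of_int_alt_sgn power_powi by simp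
  qed
  hence "(lerch_dterm has_sum (\<Sum>\<^sub>\<infinity>n. lerch_term (q ^ 3) (q ^ 10) n)) (Sigma UNIV half) \<longleftrightarrow>
    (?t has_sum (\<Sum>\<^sub>\<infinity>n. lerch_term (q ^ 3) (q ^ 10) n)) (Sigma UNIV half)"
    by (rule has_sum_cong)
  thus "(?t has_sum (\<Sum>\<^sub>\<infinity>n. lerch_term (q ^ 3) (q ^ 10) n)) (Sigma UNIV half)"
    using lerch_sums(1) by (rule iffD1)
qed

lemma lambert_series:
  "int_series lambert_fps (\<lambda>q. \<Sum>\<^sub>\<infinity>m. lambert_term (q ^ 3) (q ^ 10) m)"
  unfolding lambert_fps_def
proof (rule int_series_family)
  fix q :: complex assume q: "0 < norm q" "norm q < 1"
  interpret theta_domain "q ^ 3" "q ^ 10" by (rule theta_domain_powers[OF q])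
  have q0: "q \<noteq> 0" using q by auto
  let ?t = "\<lambda>p. of_int ((\<lambda>(m,k). hsgn m * m) p) * q ^ (\<lambda>(m,k). nat (3 * m + 10 * (m * k))) p"
  have "lambert_dterm p = ?t p" if mem: "p \<in> Sigma UNIV half" for p
  proof -
    obtain m k where p: "p = (m, k)" and k: "k \<in> half m" using mem by auto
    \<comment> \<open>Either m >= 0, or the exponent is written as 3 m (k + 1) + 7 m k.\<close>
    have e: "0 \<le> 3 * m + 10 * (m * k)"
      using half_mult_bounds[OF k] by (auto simp: algebra_simps)
    show ?thesis
      unfolding p prod.case powi_eq_power_nat[OF e, symmetric] power_int_add[OF disjI1[OF q0]]
        lambert_dterm_def power_powi by simp
  qed
  hence "(lambert_dterm has_sum (\<Sum>\<^sub>\<infinity>n. lambert_term (q ^ 3) (q ^ 10) n)) (Sigma UNIV half) \<longleftrightarrow>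
    (?t has_sum (\<Sum>\<^sub>\<infinity>n. lambert_term (q ^ 3) (q ^ 10) n)) (Sigma UNIV half)"
    by (rule has_sum_cong)
  thus "(?t has_sum (\<Sum>\<^sub>\<infinity>n. lambert_term (q ^ 3) (q ^ 10) n)) (Sigma UNIV half)"
    using lambert_sums(1) by (rule iffD1)
qed

lemma const_series:
  "int_series const_fps (\<lambda>q. \<Sum>\<^sub>\<infinity>m. const_term (q ^ 10) m)"
  unfolding const_fps_def
proof (rule int_series_family)
  fix q :: complex assume q: "0 < norm q" "norm q < 1"
  interpret theta_domain "q ^ 3" "q ^ 10" by (rule theta_domain_powers[OF q])
  let ?t = "\<lambda>p. of_int ((\<lambda>(m,k). - (hsgn m * m * alt_sgn m)) p) *
     q ^ (\<lambda>(m,k). nat (10 * (tri (m + 1) + m * k))) p"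
  have "const_dterm p = ?t p" if mem: "p \<in> Sigma UNIV half" for p
  proof -
    obtain m k where p: "p = (m, k)" and k: "k \<in> half m" using mem by auto
    have e: "0 \<le> 10 * (tri (m + 1) + m * k)"
      using half_mult_bounds[OF k] tri_bounds(1)[of "m + 1"] by simp
    show ?thesis
      unfolding p prod.case powi_eq_power_nat[OF e, symmetric]
        const_dterm_def of_int_mult of_int_minus of_int_alt_sgn power_powi by simp
  qed
  hence "(const_dterm has_sum (\<Sum>\<^sub>\<infinity>n. const_term (q ^ 10) n)) (Sigma UNIV half) \<longleftrightarrow>
    (?t has_sum (\<Sum>\<^sub>\<infinity>n. const_term (q ^ 10) n)) (Sigma UNIV half)"
    by (rule has_sum_cong)
  thus "(?t has_sum (\<Sum>\<^sub>\<infinity>n. const_term (q ^ 10) n)) (Sigma UNIV half)"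
    using const_sums(1) by (rule iffD1)
qed

text \<open>The exponent is n (5 n - 2), and 5 n = 2 has no integer solution, so only n = 0
  contributes.\<close>

lemma theta_fps_0: "fps_nth theta_fps 0 = 1"
proof -
  have *: "n = 0" if "10 * tri n + 3 * n = 0" for n
  proof -
    have "2 * (10 * tri n + 3 * n) = 10 * (2 * tri n) + 6 * n" by simp
    also have "\<dots> = 2 * (n * (5 * n - 2))" unfolding two_tri by (simp add: algebra_simps)
    finally have "n * (5 * n - 2) = 0" using that by simp
    hence "n = 0 \<or> 5 * n = 2" by simp
    thus "n = 0" by presburger
  qed
  have "nat (10 * tri n + 3 * n) = 0 \<longleftrightarrow> n = 0" for n
  proof
    assume "nat (10 * tri n + 3 * n) = 0"
    hence "10 * tri n + 3 * n = 0" using theta_exponent_nonneg[of n] by linarith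
    thus "n = 0" by (rule *)
  qed (simp add: tri_def)
  hence fiber: "{n \<in> UNIV. nat (10 * tri n + 3 * n) = 0} = {0}"
    by (intro set_eqI) (simp only: mem_Collect_eq UNIV_I simp_thms insert_iff empty_iff)
  show ?thesis
    unfolding theta_fps_def family_fps_def fps_nth_Abs_fps fiber by (simp add: alt_sgn_def)
qed

text \<open>Exponent 0 occurs for k = 0, with weight 0, and for k = - 1, with weight (- 1) (- 1) =
  1.\<close>

lemma cube_fps_0: "fps_nth cube_fps 0 = 1"
proof -
  have *: "k = 0 \<or> k = - 1" if "tri (k + 1) = 0" for k
    using two_tri[of "k + 1"] that by auto
  have "nat (10 * tri (k + 1)) = 0 \<longleftrightarrow> k = 0 \<or> k = - 1" for k
  proof
    assume "nat (10 * tri (k + 1)) = 0"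
    hence "tri (k + 1) = 0" using tri_bounds(1)[of "k + 1"] by linarith
    thus "k = 0 \<or> k = - 1" by (rule *)
  qed (auto simp: tri_def)
  hence fiber: "{k \<in> UNIV. nat (10 * tri (k + 1)) = 0} = {0, - 1}"
    by (intro set_eqI) (simp only: mem_Collect_eq UNIV_I simp_thms insert_iff empty_iff)
  show ?thesis
    unfolding cube_fps_def family_fps_def fps_nth_Abs_fps fiber by (simp add: alt_sgn_def)
qed

lemma ten_dvd_nat: "10 dvd nat (10 * z)"
  by (simp add: nat_mult_distrib)

lemma cube_fps_nth: "\<not> 10 dvd n \<Longrightarrow> fps_nth cube_fps n = 0"
  unfolding cube_fps_def
proof (rule family_fps_nth_eq_0)
  fix k :: int assume "\<not> 10 dvd n"
  thus "nat (10 * tri (k + 1)) \<noteq> n" using ten_dvd_nat[of "tri (k + 1)"] by blast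
qed

lemma const_fps_nth: "\<not> 10 dvd n \<Longrightarrow> fps_nth const_fps n = 0"
  unfolding const_fps_def
proof (rule family_fps_nth_eq_0)
  fix p :: "int \<times> int" assume n: "\<not> 10 dvd n"
  obtain m k where p: "p = (m, k)" by (cases p)
  show "(\<lambda>(m,k). nat (10 * (tri (m + 1) + m * k))) p \<noteq> n"
    using ten_dvd_nat[of "tri (m + 1) + m * k"] n unfolding p prod.case by blast
qed

text \<open>On this fibre m (10 k + 3) = 10 n + 5, so 5 divides 3 m and hence m; the weight
  \<open>hsgn m * m\<close> is the absolute value of m.\<close>

lemma lambert_fps_nth: "\<exists>c::int. fps_nth lambert_fps (10 * n + 5) = of_int (5 * c)"
proof -
  let ?w = "\<lambda>(m::int,k::int). hsgn m * m"
  let ?A = "{p \<in> Sigma UNIV half. (\<lambda>(m,k). nat (3 * m + 10 * (m * k))) p = 10 * n + 5}"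
  have "5 dvd infsum ?w ?A"
  proof (rule dvd_infsum_int)
    fix p assume "p \<in> ?A"
    then obtain m k where p: "p = (m, k)" "nat (3 * m + 10 * (m * k)) = 10 * n + 5" by auto
    hence "3 * m = 5 * (2 * int n + 1 - 2 * (m * k))" by (simp add: nat_eq_iff algebra_simps split: if_splits)
    hence "5 dvd 3 * m" by (rule dvdI)
    hence "5 dvd m" by presburger
    thus "5 dvd ?w p" by (simp add: p)
  qed
  thus ?thesis by (auto simp: lambert_fps_def family_fps_def elim!: dvdE)
qed

section \<open>The generating function and its power series\<close>

lemma appell_gf_eq:
  assumes q: "0 < norm q" "norm q < 1"
  shows "appell_gf 3 10 q = (\<Sum>\<^sub>\<infinity>n. lerch_term (q ^ 3) (q ^ 10) n) *
           inverse (\<Sum>\<^sub>\<infinity>n. theta_term (q ^ 3) (q ^ 10) n)"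
    and "(\<Sum>\<^sub>\<infinity>n. theta_term (q ^ 3) (q ^ 10) n) \<noteq> 0"
proof -
  interpret theta_domain "q ^ 3" "q ^ 10" by (rule theta_domain_powers[OF q])
  have q0: "q \<noteq> 0" using q by auto
  have e: "q ^ 10 / q ^ 3 = q ^ 7"
    using q0 by (simp add: field_simps flip: power_add)
  \<comment> \<open>The triple product at x = q^3 and base q^10 has q / x = q^7, so it is exactly
    the denominator of \<open>appell_gf 3 10\<close>.\<close>
  have th: "(\<Sum>\<^sub>\<infinity>n. theta_term (q ^ 3) (q ^ 10) n) =
      qpoch_inf (q ^ 3) (q ^ 10) * qpoch_inf (q ^ 7) (q ^ 10) * qpoch_inf (q ^ 10) (q ^ 10)"
    using infsumI[OF jacobi_triple_product[OF theta_domain.q0 qx x1]] theta_domain_axioms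
    unfolding e by simp
  show "(\<Sum>\<^sub>\<infinity>n. theta_term (q ^ 3) (q ^ 10) n) \<noteq> 0"
    unfolding th using q by (auto simp: qpoch_inf_nonzero norm_power power_less_one_iff)
  have "(- 1) powi n * q powi (int 10 * n * (n + 1) div 2 + int 3 * n + int 3) / (1 - q powi (int 10 * n + int 3))
      = lerch_term (q ^ 3) (q ^ 10) n" for n
  proof -
    have "int 10 * n * (n + 1) = 2 * (10 * tri (n + 1))"
      using two_tri[of "n + 1"] by (simp add: algebra_simps)
    hence "int 10 * n * (n + 1) div 2 = 10 * tri (n + 1)" by simp
    moreover have "q powi (10 * tri (n + 1) + int 3 * n + int 3) = (q ^ 10) powi tri (n + 1) * (q ^ 3) powi (n + 1)"
      using power_int_add[OF disjI1[OF q0], of "10 * tri (n + 1)" "3 * (n + 1)"]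
      unfolding power_powi by (simp add: algebra_simps)
    moreover have "q powi (int 10 * n + int 3) = q ^ 3 * (q ^ 10) powi n"
      using power_int_add[OF disjI1[OF q0], of "10 * n" 3] unfolding power_powi by simp
    ultimately show ?thesis by (simp only: lerch_term_def mult.assoc)
  qed
  thus "appell_gf 3 10 q = (\<Sum>\<^sub>\<infinity>n. lerch_term (q ^ 3) (q ^ 10) n) *
           inverse (\<Sum>\<^sub>\<infinity>n. theta_term (q ^ 3) (q ^ 10) n)"
    unfolding appell_gf_def th by (simp add: divide_inverse)
qed

definition "appell_fps = lerch_fps * inverse theta_fps"

lemma appell_series: "int_series appell_fps (appell_gf 3 10)"
  unfolding appell_fps_def
  by (rule int_series_cong[OF int_series_mult[OF lerch_series int_series_inverse[OF theta_series theta_fps_0]]])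
     (auto simp: appell_gf_eq)

text \<open>Both sides expand the same function on the punctured disc: substituting
  \<open>appell_gf_eq\<close> into \<open>lerch_lambert_identity\<close> cancels the nonzero theta
  series.\<close>

lemma appell_fps_equation: "cube_fps * appell_fps = const_fps + lambert_fps"
proof (rule int_series_unique)
  show "int_series (const_fps + lambert_fps)
     (\<lambda>q. (\<Sum>\<^sub>\<infinity>m. const_term (q ^ 10) m) + (\<Sum>\<^sub>\<infinity>m. lambert_term (q ^ 3) (q ^ 10) m))"
    by (intro int_series_add const_series lambert_series)
  show "int_series (cube_fps * appell_fps)
     (\<lambda>q. (\<Sum>\<^sub>\<infinity>m. const_term (q ^ 10) m) + (\<Sum>\<^sub>\<infinity>m. lambert_term (q ^ 3) (q ^ 10) m))"
  proof (rule int_series_cong[OF int_series_mult[OF cube_series appell_series]])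
    fix q :: complex assume q: "0 < norm q" "norm q < 1"
    interpret theta_domain "q ^ 3" "q ^ 10" by (rule theta_domain_powers[OF q])
    show "(\<Sum>\<^sub>\<infinity>k. cube_term (q ^ 10) k) * appell_gf 3 10 q =
       (\<Sum>\<^sub>\<infinity>m. const_term (q ^ 10) m) + (\<Sum>\<^sub>\<infinity>m. lambert_term (q ^ 3) (q ^ 10) m)"
      unfolding appell_gf_eq(1)[OF q] mult.assoc[symmetric] lerch_lambert_identity
      using appell_gf_eq(2)[OF q] by simp
  qed
qed

lemma appell_coeff_eq: "of_int (appell_coeff 3 10 n) = fps_nth appell_fps n"
proof -
  have "\<forall>n. \<exists>c. fps_nth appell_fps n = of_int c"
    using appell_series by (auto simp: int_series_def elim!: Ints_cases)
  then obtain a where a: "\<And>n. fps_nth appell_fps n = of_int (a n)" by metis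
  \<comment> \<open>The definite description needs existence, given by the integrality of
    \<open>appell_fps\<close>, and uniqueness, given by \<open>int_series_unique\<close>.\<close>
  have "appell_coeff 3 10 = a" unfolding appell_coeff_def
  proof (rule the_equality)
    show "\<forall>q. 0 < norm q \<and> norm q < 1 \<longrightarrow> (\<lambda>n. of_int (a n) * q ^ n) sums appell_gf 3 10 q"
      using int_series_sums[OF appell_series] by (simp only: a) blast
  next
    fix b :: "nat \<Rightarrow> int"
    assume b: "\<forall>q. 0 < norm q \<and> norm q < 1 \<longrightarrow> (\<lambda>n. of_int (b n) * q ^ n) sums appell_gf 3 10 q"
    have "int_series (Abs_fps (\<lambda>n. of_int (b n))) (appell_gf 3 10)"
      by (rule int_seriesI) (use b in auto)
    hence "Abs_fps (\<lambda>n. of_int (b n)) = appell_fps"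
      by (rule int_series_unique[OF _ appell_series])
    hence "of_int (b n) = (of_int (a n) :: complex)" for n
      using a[of n] by (metis fps_nth_Abs_fps)
    thus "b = a" by (simp add: fun_eq_iff)
  qed
  thus ?thesis by (simp add: a)
qed

section \<open>Divisibility by recursion\<close>

theorem mainTheorem5:
  fixes n :: nat
  shows "[appell_coeff 3 10 (10 * n + 5) = 0] (mod 5)"
proof (induction n rule: less_induct)
  case (less n)
  define N where "N = 10 * n + 5"
  have N: "\<not> 10 dvd N" unfolding N_def by presburger
  obtain c :: int where c: "fps_nth lambert_fps N = of_int (5 * c)"
    using lambert_fps_nth unfolding N_def by blast
  have "\<forall>i. \<exists>c. fps_nth cube_fps i = of_int c"
    using cube_series by (auto simp: int_series_def elim!: Ints_cases)
  then obtain d where d: "\<And>i. fps_nth cube_fps i = of_int (d i)" by metis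
  \<comment> \<open>Compare the coefficients of q^N in \<open>appell_fps_equation\<close>;
    \<open>const_fps\<close> contributes nothing, as 10 does not divide \<open>N\<close>.\<close>
  have "(\<Sum>i=0..N. fps_nth cube_fps i * fps_nth appell_fps (N - i)) = fps_nth lambert_fps N"
    using arg_cong[OF appell_fps_equation, of "\<lambda>f. fps_nth f N"] const_fps_nth[OF N]
    unfolding fps_mult_nth[of cube_fps] by simp
  hence "of_int (\<Sum>i=0..N. d i * appell_coeff 3 10 (N - i)) = (of_int (5 * c) :: complex)"
    unfolding c d appell_coeff_eq[symmetric] by simp
  hence "(\<Sum>i=0..N. d i * appell_coeff 3 10 (N - i)) = 5 * c"
    by (simp only: of_int_eq_iff)
  moreover have "d 0 = 1" using cube_fps_0 unfolding d by simp
  \<comment> \<open>The summand i = 0 has coefficient 1 and isolates the wanted value.\<close>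
  ultimately have eq: "appell_coeff 3 10 N = 5 * c - (\<Sum>i=1..N. d i * appell_coeff 3 10 (N - i))"
    by (simp add: sum.atLeast_Suc_atMost)
  \<comment> \<open>Only multiples i = 10 j survive, and these lower the index to 10 (n - j) + 5,
    where the induction hypothesis applies.\<close>
  have "5 dvd d i * appell_coeff 3 10 (N - i)" if i: "i \<in> {1..N}" for i
  proof (cases "10 dvd i")
    case True
    then obtain j where j: "i = 10 * j" by (rule dvdE)
    have "n - j < n" "N - i = 10 * (n - j) + 5" using i unfolding j N_def by auto
    with less.IH[of "n - j"] show ?thesis by (simp add: cong_0_iff)
  next
    case False
    hence "d i = 0" using cube_fps_nth[of i] unfolding d by simp
    thus ?thesis by simp
  qed
  hence "5 dvd (\<Sum>i=1..N. d i * appell_coeff 3 10 (N - i))" by (rule dvd_sum)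
  thus ?case unfolding N_def[symmetric] eq cong_0_iff by (intro dvd_diff) auto
qed

end
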